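(* Suppose that $B(q)=\sum_{n\ge 0} b_n q^n$ is a power series with non-negative real coefficients and radius of convergence at least one. Let $\lambda,\alpha,\beta,\gamma$ be real numbers with $\gamma>0$ such that $$B(e^{-t}) \sim \lambda \log\left(\tfrac1t\right)^\alpha t^\beta e^{\frac{\gamma}{t}}\quad\text{as } t\to 0^+,$$ and such that, for each $\Delta>0$, $$B(e^{-z}) \ll \log\left(\tfrac{1}{|z|}\right)^\alpha |z|^\beta e^{\frac{\gamma}{|z|}}\quad\text{as } z\to 0$$ with $z=x+iy$ ($x,y\in\mathbb{R}$, $x>0$) in the region $|y|\le \Delta x$. Then $$\sum_{n=0}^{N} b_n \sim \frac{\lambda\, \gamma^{\frac{\beta}{2}-\frac14}\log(N)^\alpha}{2^{\alpha+1}\sqrt{\pi}\,N^{\frac{\beta}{2}+\frac14}}\,e^{2\sqrt{\gamma N}}\quad\text{as } N\to\infty.$$ Furthermore, if the $b_n$ are weakly increasing, then $$b_n \sim \frac{\lambda\, \gamma^{\frac{\beta}{2}+\frac14}\log(n)^\alpha}{2^{\alpha+1}\sqrt{\pi}\,n^{\frac{\beta}{2}+\frac34}}\,e^{2\sqrt{\gamma n}}\quad\text{as } n\to\infty.$$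
   Context: Here $\log(u)^\alpha$ means $(\log u)^\alpha$. The implied constant in the bound $\ll$ may depend on $\Delta$. *)

theory Defs
  imports "HOL-Analysis.Analysis" "HOL-Library.Landau_Symbols"
begin

end

theory Submission
  imports Defs "HOL-Probability.Probability" "HOL-Complex_Analysis.Great_Picard"
    "HOL-Real_Asymp.Real_Asymp"
begin

text \<open>
Write \<open>f x\<close> for the series \<open>\<Sum>n. b n * exp (- n x)\<close> and \<open>F z\<close> for the same series at a complex
point, so that \<open>F z = B (exp (- z))\<close>. For a large index \<open>N\<close> put \<open>x = sqrt (\<gamma> / N)\<close>, the saddle point
of \<open>\<gamma> / x + N x\<close>, and regard \<open>b n * exp (- n x)\<close> as a mass placed at \<open>n\<close>. The proof shows that this tilted
mass is, close to \<open>N\<close>, evenly spread at the scale \<open>1 / x\<close>; this takes two steps.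

The first step is a central limit theorem at the coarser scale \<open>x powr (- 3 / 2)\<close>. For
\<open>z = x + x powr (3 / 2) * w\<close> one has \<open>\<gamma> / z + N z = 2 sqrt (\<gamma> N) + \<gamma> w^2 + o(1)\<close>, so for real \<open>w\<close>
the radial asymptotics say exactly that the normalised moment generating functions tend to \<open>exp (\<gamma> w^2)\<close>
(\<open>tilted_mgf_limit\<close>). On a complex disc such a function is bounded by its values at two real points, so
Montel's theorem extends the convergence to \<open>w = \<i> s\<close> (\<open>tilted_char_limit\<close>).

The second step refines this to the scale \<open>1 / x\<close>, and here the bound in sectors is essential. If
\<open>\<bar>u\<bar> \<le> \<Delta>\<close> then \<open>1 / \<bar>1 + \<i> u\<bar> \<le> 1 - c u^2\<close> for some \<open>c > 0\<close>, and therefore \<open>F (x + \<i> x u)\<close> is at most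
\<open>C exp (- c u^2 / x) f x\<close> (\<open>angular_gaussian_bound\<close>): an integral of \<open>F (x + \<i> x u)\<close> over a bounded
range of \<open>u\<close> is dominated by a Gaussian of width \<open>sqrt x\<close>, on which the first step gives the pointwise limit. In order
that only bounded \<open>u\<close> occur, the mass at \<open>n\<close> is multiplied by \<open>weight (x (n - N))\<close>, where \<open>weight\<close> is
a strictly positive integrable function whose Fourier transform \<open>weight_hat\<close> has compact support. Dominated
convergence then evaluates the limits of all characteristic functions of the weighted measures
(\<open>weighted_iexp_limit\<close>), and Levy's continuity theorem turns them into a local limit theorem
(\<open>local_limit\<close>): divided by \<open>f x * sqrt x / (2 sqrt (\<pi> \<gamma>))\<close>, the mass of the points \<open>x (n - N)\<close>
converges to Lebesgue measure when tested against any Borel function that is dominated by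
\<open>weight\<close> and continuous outside a finite set. The weight can be divided out again because it has no zeros.

The test function \<open>exp v\<close> on \<open>v \<le> 0\<close> yields the partial sums, since
\<open>\<Sum>n\<le>N. b n = exp (N x) * (\<Sum>n\<le>N. b n * exp (- n x) * exp (x (n - N)))\<close>. For increasing \<open>b\<close> the value
\<open>b N\<close> is squeezed between averages over the windows \<open>[- d, 0]\<close> and \<open>[0, d]\<close>, with \<open>d\<close> tending to zero.
It remains to insert the radial asymptotics of \<open>f x\<close> at the saddle point (\<open>saddle_limit\<close>).
\<close>

section \<open>A band-limited positive weight and its Fourier transform\<close>

definition triangle :: "real \<Rightarrow> real" where "triangle u = max 0 (1 - \<bar>u\<bar>)"

text \<open>
The Fourier transform of the triangle function, namely the square of sin (v / 2) / (v / 2).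
\<close>

definition fejer :: "real \<Rightarrow> real" where
  "fejer v = (if v = 0 then 1 else 2 * (1 - cos v) / v\<^sup>2)"

lemma fejer_minus [simp]: "fejer (- v) = fejer v"
  by (simp add: fejer_def)

lemma isCont_fejer: "isCont fejer v"
proof -
  have "cos v = 1 - 2 * (sin (v / 2))\<^sup>2" for v :: real
    using cos_double_sin[of "v / 2"] by simp
  then have eq: "fejer = (\<lambda>v. (sinc (v / 2))\<^sup>2)"
    by (auto simp: fejer_def fun_eq_iff power_divide)
  have "isCont (\<lambda>v. v / 2) v"
    by (intro continuous_intros) auto
  then show ?thesis
    unfolding eq by (intro isCont_power isCont_o2[OF _ isCont_sinc])
qed

lemma fejer_measurable [measurable]: "fejer \<in> borel_measurable borel"
  unfolding fejer_def by measurable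

lemma triangle_measurable [measurable]: "triangle \<in> borel_measurable borel"
  unfolding triangle_def by measurable

lemma isCont_triangle: "isCont triangle u"
  unfolding triangle_def by (intro continuous_intros)

text \<open>
Integration by parts on [0, 1], with an explicit antiderivative; the integrand is even.
\<close>

lemma has_bochner_integral_triangle_cos:
  "has_bochner_integral lborel (\<lambda>u. triangle u * cos (u * v)) (fejer v)"
proof -
  define F where "F = (\<lambda>u. if v = 0 then u - u\<^sup>2 / 2 else (1 - u) * sin (u * v) / v - cos (u * v) / v\<^sup>2)"
  have "has_bochner_integral lborel (\<lambda>u. indicator {0..1} u *\<^sub>R ((1 - u) * cos (u * v))) (F 1 - F 0)"
  proof (rule has_bochner_integral_FTC_Icc)
    show "(F has_vector_derivative (1 - u) * cos (u * v)) (at u within {0..1})" for u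
    proof (cases "v = 0")
      case True
      have "((\<lambda>u. u - u\<^sup>2 / 2) has_real_derivative (1 - u)) (at u within {0..1})"
        by (auto intro!: derivative_eq_intros)
      then show ?thesis
        using True by (simp add: F_def has_real_derivative_iff_has_vector_derivative)
    next
      case False
      have "((\<lambda>u. (1 - u) * sin (u * v) / v - cos (u * v) / v\<^sup>2) has_real_derivative (1 - u) * cos (u * v))
              (at u within {0..1})"
        using False by (auto intro!: derivative_eq_intros simp: field_simps power2_eq_square)
      then show ?thesis
        using False by (simp add: F_def has_real_derivative_iff_has_vector_derivative)
    qed
  qed (auto intro!: continuous_intros)
  also have "(\<lambda>u. indicator {0..1} u *\<^sub>R ((1 - u) * cos (u * v)))
      = (\<lambda>u. indicator {0..} u *\<^sub>R (triangle u * cos (u * v)))"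
    by (auto simp: fun_eq_iff triangle_def indicator_def)
  finally have "has_bochner_integral lborel (\<lambda>u. triangle u * cos (u * v)) (2 *\<^sub>R (F 1 - F 0))"
    by (rule has_bochner_integral_even_function) (simp add: triangle_def)
  also have "2 *\<^sub>R (F 1 - F 0) = fejer v"
    by (auto simp: F_def fejer_def field_simps)
  finally show ?thesis .
qed

lemma integral_odd_eq_0:
  fixes f :: "real \<Rightarrow> real"
  assumes "\<And>x. f (- x) = - f x"
  shows "integral\<^sup>L lborel f = 0"
proof -
  have "integral\<^sup>L lborel f = integral\<^sup>L lborel (\<lambda>x. f (- x))"
    using lborel_integral_real_affine[of "-1" f 0] by simp
  with assms show ?thesis by simp
qed

text \<open>
The sine part of the Fourier integral of an even function vanishes, so the cosine integral is enough.
\<close>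

lemma has_bochner_integral_iexp_even:
  fixes f :: "real \<Rightarrow> real"
  assumes f: "integrable lborel f" and even: "\<And>x. f (- x) = f x"
    and cos: "has_bochner_integral lborel (\<lambda>u. f u * cos (t * u)) c"
  shows "has_bochner_integral lborel (\<lambda>u. f u *\<^sub>R iexp (t * u)) (complex_of_real c)"
proof -
  have [measurable]: "f \<in> borel_measurable borel"
    using f by auto
  have "integrable lborel (\<lambda>u. f u * sin (t * u))"
    by (rule Bochner_Integration.integrable_bound[OF f]) (auto simp: abs_mult mult_left_le)
  moreover have "integral\<^sup>L lborel (\<lambda>u. f u * sin (t * u)) = 0"
    by (rule integral_odd_eq_0) (simp add: even)
  ultimately have sin: "has_bochner_integral lborel (\<lambda>u. f u * sin (t * u)) 0"
    by (simp add: has_bochner_integral_iff)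
  have "has_bochner_integral lborel (\<lambda>u. of_real (f u * cos (t * u)) + \<i> * of_real (f u * sin (t * u)))
     (of_real c + \<i> * of_real 0)"
    by (intro has_bochner_integral_add has_bochner_integral_mult_right has_bochner_integral_of_real cos sin)
  then show ?thesis
    by (simp add: cis_conv_exp[symmetric] cis.ctr complex_eq_iff scaleR_conv_of_real algebra_simps
        exp_eq_polar Complex_eq)
qed

lemma has_bochner_integral_triangle_iexp:
  "has_bochner_integral lborel (\<lambda>u. triangle u *\<^sub>R iexp (v * u)) (complex_of_real (fejer v))"
proof (rule has_bochner_integral_iexp_even)
  show "integrable lborel triangle"
    using has_bochner_integral_triangle_cos[of 0] by (simp add: has_bochner_integral_iff)
  show "has_bochner_integral lborel (\<lambda>u. triangle u * cos (v * u)) (fejer v)"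
    using has_bochner_integral_triangle_cos[of v] by (simp add: mult.commute[of v])
qed (simp add: triangle_def)

text \<open>
An antiderivative of (1 - cos v) / v^2 is Si v - (1 - cos v) / v, so the case a = 1 reduces to the limit
pi / 2 of the sine integral. The other values of a follow by scaling.
\<close>

lemma has_bochner_integral_one_minus_cos_over_square:
  "has_bochner_integral lborel (\<lambda>v. (1 - cos (a * v)) / v\<^sup>2) (pi * \<bar>a\<bar>)"
proof -
  let ?f = "\<lambda>v::real. (1 - cos v) / v\<^sup>2"
  let ?F = "\<lambda>v::real. Si v - (1 - cos v) / v"
  have der: "DERIV ?F v :> ?f v" if "v > 0" for v
    using that by (auto intro!: derivative_eq_intros DERIV_Si simp: field_simps power2_eq_square)
  have lim0: "(?F \<longlongrightarrow> 0) (at_right 0)"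
  proof -
    have "(Si \<longlongrightarrow> Si 0) (at_right 0)"
      using isCont_Si[of 0] by (auto simp: isCont_def intro: tendsto_within_subset)
    moreover have "Si 0 = 0"
      by (simp add: Si_alt_def zero_ereal_def[symmetric])
    moreover have "((\<lambda>v::real. (1 - cos v) / v) \<longlongrightarrow> 0) (at_right 0)"
      by real_asymp
    ultimately show ?thesis
      using tendsto_diff by force
  qed
  have limtop: "(?F \<longlongrightarrow> pi / 2) at_top"
  proof -
    have "((\<lambda>v::real. (1 - cos v) / v) \<longlongrightarrow> 0) at_top"
    proof (rule Lim_null_comparison)
      show "\<forall>\<^sub>F v in at_top. norm ((1 - cos v) / v) \<le> 2 / (v::real)"
        using eventually_gt_at_top[of 0]
      proof eventually_elim
        case (elim v)
        have "\<bar>1 - cos v\<bar> \<le> 2"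
          using cos_le_one[of v] cos_ge_minus_one[of v] by linarith
        with elim show ?case by (simp add: divide_right_mono)
      qed
    qed real_asymp
    from tendsto_diff[OF Si_at_top this] show ?thesis by simp
  qed
  have lims: "((?F \<circ> real_of_ereal) \<longlongrightarrow> 0) (at_right 0)"
      "((?F \<circ> real_of_ereal) \<longlongrightarrow> pi / 2) (at_left \<infinity>)"
    using lim0 limtop by (simp_all add: zero_ereal_def ereal_tendsto_simps)
  have cont: "isCont ?f v" if "0 < v" for v
    using that by (intro continuous_intros) auto
  have nonneg: "AE v in lborel. 0 < ereal v \<longrightarrow> ereal v < \<infinity> \<longrightarrow> 0 \<le> ?f v"
    by (intro always_eventually) simp
  note FTC = interval_integral_FTC_nonneg[of 0 \<infinity> ?F ?f, OF _ der cont nonneg lims, simplified]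
  have eint: "einterval 0 \<infinity> = {0<..}"
    by (auto simp: einterval_def)
  have "has_bochner_integral lborel (\<lambda>v. indicator {0<..} v *\<^sub>R ?f v) (pi / 2)"
    using FTC by (simp add: has_bochner_integral_iff interval_lebesgue_integral_def eint
        set_integrable_def set_lebesgue_integral_def)
  also have "(\<lambda>v. indicator {0<..} v *\<^sub>R ?f v) = (\<lambda>v. indicator {0..} v *\<^sub>R ?f v)"
    by (auto simp: fun_eq_iff indicator_def)
  finally have 1: "has_bochner_integral lborel ?f (2 *\<^sub>R (pi / 2))"
    by (rule has_bochner_integral_even_function) auto
  show ?thesis
  proof (cases "a = 0")
    case False
    have "has_bochner_integral lborel (\<lambda>v. ?f (0 + a * v)) ((2 *\<^sub>R (pi / 2)) /\<^sub>R \<bar>a\<bar>)"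
      using 1 False by (subst lborel_has_bochner_integral_real_affine_iff[symmetric]) auto
    from has_bochner_integral_mult_right[OF this, of "a\<^sup>2"]
    have "has_bochner_integral lborel (\<lambda>v. a\<^sup>2 * ?f (0 + a * v)) (a\<^sup>2 * ((2 *\<^sub>R (pi / 2)) /\<^sub>R \<bar>a\<bar>))" .
    moreover have "a\<^sup>2 * ?f (0 + a * v) = (1 - cos (a * v)) / v\<^sup>2" for v
      using False by (simp add: power_mult_distrib)
    moreover have "a\<^sup>2 * ((2 *\<^sub>R (pi / 2)) /\<^sub>R \<bar>a\<bar>) = pi * \<bar>a\<bar>"
      using False by (simp add: abs_if power2_eq_square)
    ultimately show ?thesis
      by (simp only:)
  qed auto
qed

text \<open>
Fourier inversion for the triangle function. The product-to-sum formula writes 2 (1 - cos v) cos (t v) as a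
combination of terms 1 - cos (a v) with a = t + 1, t - 1, t, which reduces the integral to the previous lemma;
the resulting combination of absolute values is the second difference that defines the triangle.
\<close>

lemma has_bochner_integral_fejer_cos:
  "has_bochner_integral lborel (\<lambda>v. fejer v * cos (t * v)) (2 * pi * triangle t)"
proof -
  let ?J = "\<lambda>a v::real. (1 - cos (a * v)) / v\<^sup>2"
  have "has_bochner_integral lborel (\<lambda>v. ?J (t + 1) v + ?J (t - 1) v - 2 * ?J t v)
          (pi * \<bar>t + 1\<bar> + pi * \<bar>t - 1\<bar> - 2 * (pi * \<bar>t\<bar>))"
    by (intro has_bochner_integral_add has_bochner_integral_diff has_bochner_integral_mult_right
        has_bochner_integral_one_minus_cos_over_square)
  moreover have "pi * \<bar>t + 1\<bar> + pi * \<bar>t - 1\<bar> - 2 * (pi * \<bar>t\<bar>) = 2 * pi * triangle t"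
    by (simp add: triangle_def max_def abs_if algebra_simps)
  ultimately have "has_bochner_integral lborel (\<lambda>v. ?J (t + 1) v + ?J (t - 1) v - 2 * ?J t v) (2 * pi * triangle t)"
    by simp
  also have "?this \<longleftrightarrow> ?thesis"
  proof (rule has_bochner_integral_cong_AE)
    have "?J (t + 1) v + ?J (t - 1) v - 2 * ?J t v = fejer v * cos (t * v)" if "v \<noteq> 0" for v
      using that by (simp add: fejer_def cos_add cos_diff ring_distribs field_simps)
    then show "AE v in lborel. ?J (t + 1) v + ?J (t - 1) v - 2 * ?J t v = fejer v * cos (t * v)"
      using AE_lborel_singleton[of 0] by (auto elim!: eventually_mono)
  qed auto
  finally show ?thesis .
qed

lemma has_bochner_integral_fejer_iexp:
  "has_bochner_integral lborel (\<lambda>v. fejer v *\<^sub>R iexp (t * v)) (complex_of_real (2 * pi * triangle t))"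
proof (rule has_bochner_integral_iexp_even)
  show "integrable lborel fejer"
    using has_bochner_integral_fejer_cos[of 0] by (simp add: has_bochner_integral_iff)
qed (use has_bochner_integral_fejer_cos in auto)

text \<open>
The Fejer kernel vanishes at the nonzero multiples of 2 pi. Adding two copies whose shifts differ by pi removes
all zeros; placing the shifts symmetrically keeps the transform real and even.
\<close>

definition weight :: "real \<Rightarrow> real" where "weight v = fejer (v - pi / 2) + fejer (v + pi / 2)"
definition weight_hat :: "real \<Rightarrow> real" where "weight_hat u = 2 * cos (pi / 2 * u) * triangle u"

text \<open>
Both summands have the numerators 2 (1 - sin v) and 2 (1 + sin v), whose sum is 4, over denominators that are at
most the one on the right.
\<close>

lemma weight_lower: "weight v \<ge> 4 / (\<bar>v\<bar> + pi / 2)\<^sup>2"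
proof -
  have D: "\<bar>v\<bar> + pi / 2 > 0"
    using pi_gt_zero by linarith
  have *: "fejer y \<ge> 2 * (1 - cos y) / (\<bar>v\<bar> + pi / 2)\<^sup>2" if y: "\<bar>y\<bar> \<le> \<bar>v\<bar> + pi / 2" for y
  proof (cases "y = 0")
    case False
    have "y\<^sup>2 \<le> (\<bar>v\<bar> + pi / 2)\<^sup>2"
      using power_mono[OF y, of 2] by simp
    then show ?thesis
      using False by (auto simp: fejer_def intro!: divide_left_mono mult_pos_pos)
  qed (simp add: fejer_def)
  have "4 / (\<bar>v\<bar> + pi / 2)\<^sup>2
      = 2 * (1 - cos (v - pi / 2)) / (\<bar>v\<bar> + pi / 2)\<^sup>2 + 2 * (1 - cos (v + pi / 2)) / (\<bar>v\<bar> + pi / 2)\<^sup>2"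
    by (simp add: cos_add cos_diff flip: add_divide_distrib)
  also have "\<dots> \<le> weight v"
    unfolding weight_def using pi_gt_zero by (intro add_mono *) linarith+
  finally show ?thesis .
qed

lemma weight_pos: "weight v > 0"
proof -
  have "\<bar>v\<bar> + pi / 2 > 0"
    using pi_gt_zero by linarith
  then have "4 / (\<bar>v\<bar> + pi / 2)\<^sup>2 > 0" by simp
  with weight_lower[of v] show ?thesis by linarith
qed

lemma isCont_weight: "isCont weight v"
  unfolding weight_def by (intro continuous_intros isCont_o2[OF _ isCont_fejer])

lemma isCont_weight_hat: "isCont weight_hat u"
  unfolding weight_hat_def by (intro continuous_intros isCont_triangle)

lemma abs_weight_hat_le: "\<bar>weight_hat u\<bar> \<le> 2"
proof -
  have "\<bar>cos (pi / 2 * u)\<bar> * \<bar>triangle u\<bar> \<le> 1 * 1"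
    by (intro mult_mono) (auto simp: triangle_def)
  then show ?thesis by (simp add: weight_hat_def abs_mult)
qed

lemma weight_hat_eq_0: "\<bar>u\<bar> \<ge> 1 \<Longrightarrow> weight_hat u = 0"
  by (simp add: weight_hat_def triangle_def)

lemma weight_hat_minus [simp]: "weight_hat (- u) = weight_hat u"
  by (simp add: weight_hat_def triangle_def)

lemma weight_measurable [measurable]: "weight \<in> borel_measurable borel"
  unfolding weight_def by measurable

lemma weight_hat_measurable [measurable]: "weight_hat \<in> borel_measurable borel"
  unfolding weight_hat_def by measurable

lemma iexp_shift_sum: "iexp (x - a) + iexp (x + a) = (2 * cos a) *\<^sub>R iexp x"
  by (simp add: exp_add exp_diff cis_conv_exp[symmetric] complex_eq_iff field_simps
      cos_add cos_diff sin_add sin_diff ring_distribs flip: of_real_add of_real_diff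
      mult.commute[of \<i>])

lemma has_bochner_integral_weight_hat_iexp:
  "has_bochner_integral lborel (\<lambda>u. weight_hat u *\<^sub>R iexp (v * u)) (complex_of_real (weight v))"
proof -
  have "has_bochner_integral lborel (\<lambda>u. triangle u *\<^sub>R iexp ((v - pi / 2) * u) + triangle u *\<^sub>R iexp ((v + pi / 2) * u))
      (complex_of_real (fejer (v - pi / 2)) + complex_of_real (fejer (v + pi / 2)))"
    by (intro has_bochner_integral_add has_bochner_integral_triangle_iexp)
  also have "(\<lambda>u. triangle u *\<^sub>R iexp ((v - pi / 2) * u) + triangle u *\<^sub>R iexp ((v + pi / 2) * u))
      = (\<lambda>u. weight_hat u *\<^sub>R iexp (v * u))"
  proof
    fix u
    show "triangle u *\<^sub>R iexp ((v - pi / 2) * u) + triangle u *\<^sub>R iexp ((v + pi / 2) * u) = weight_hat u *\<^sub>R iexp (v * u)"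
      using iexp_shift_sum[of "v * u" "pi / 2 * u"]
      by (simp only: weight_hat_def ring_distribs flip: scaleR_add_right) (simp add: mult_ac)
  qed
  finally show ?thesis by (simp add: weight_def)
qed

lemma has_bochner_integral_weight_iexp:
  "has_bochner_integral lborel (\<lambda>v. weight v *\<^sub>R iexp (t * v)) (complex_of_real (2 * pi * weight_hat t))"
proof -
  have *: "has_bochner_integral lborel (\<lambda>v. fejer (v + a) *\<^sub>R iexp (t * v))
      (iexp (- (t * a)) * complex_of_real (2 * pi * triangle t))" for a
  proof -
    have "has_bochner_integral lborel (\<lambda>v. fejer (a + 1 * v) *\<^sub>R iexp (t * (a + 1 * v)))
       (complex_of_real (2 * pi * triangle t) /\<^sub>R \<bar>1\<bar>)"
      using has_bochner_integral_fejer_iexp[of t]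
      by (subst lborel_has_bochner_integral_real_affine_iff[symmetric]) auto
    from has_bochner_integral_mult_right[OF this, of "iexp (- (t * a))"]
    moreover have "iexp (- (t * a)) * (fejer (a + 1 * v) *\<^sub>R iexp (t * (a + 1 * v))) = fejer (v + a) *\<^sub>R iexp (t * v)" for v
    proof -
      have "iexp (- (t * a)) * iexp (t * (a + 1 * v)) = iexp (t * v)"
        unfolding exp_add[symmetric] by (simp add: distrib_left)
      then show ?thesis
        by (simp only: mult_scaleR_right mult_1 add.commute)
    qed
    ultimately show ?thesis
      by (simp only: scaleR_one abs_one inverse_1)
  qed
  have "has_bochner_integral lborel (\<lambda>v. fejer (v + (- (pi / 2))) *\<^sub>R iexp (t * v) + fejer (v + pi / 2) *\<^sub>R iexp (t * v))
      (iexp (- (t * - (pi / 2))) * complex_of_real (2 * pi * triangle t) +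
       iexp (- (t * (pi / 2))) * complex_of_real (2 * pi * triangle t))"
    by (intro has_bochner_integral_add *)
  moreover have "iexp (- (t * - (pi / 2))) + iexp (- (t * (pi / 2))) = complex_of_real (2 * cos (pi / 2 * t))"
    using iexp_shift_sum[of 0 "t * (pi / 2)"] by (simp add: scaleR_conv_of_real ac_simps)
  then have "iexp (- (t * - (pi / 2))) * complex_of_real (2 * pi * triangle t) +
       iexp (- (t * (pi / 2))) * complex_of_real (2 * pi * triangle t) = complex_of_real (2 * pi * weight_hat t)"
    unfolding distrib_right[symmetric] by (simp add: weight_hat_def)
  ultimately show ?thesis
    by (simp add: weight_def scaleR_add_left)
qed

section \<open>Convergence of normal families\<close>

text \<open>
Vitali's theorem. By Montel's theorem every subsequence has a further subsequence that converges locally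
uniformly to a holomorphic function; this limit agrees with g on U, hence everywhere by the identity theorem.
\<close>

lemma vitali_convergence:
  fixes f :: "nat \<Rightarrow> complex \<Rightarrow> complex"
  assumes S: "open S" "connected S"
    and hol: "\<And>n. f n holomorphic_on S" "g holomorphic_on S"
    and bounded: "\<And>K. compact K \<Longrightarrow> K \<subseteq> S \<Longrightarrow> \<exists>C. \<forall>n. \<forall>z\<in>K. norm (f n z) \<le> C"
    and U: "U \<subseteq> S" "\<xi> \<in> S" "\<xi> islimpt U"
    and conv: "\<And>z. z \<in> U \<Longrightarrow> (\<lambda>n. f n z) \<longlonglongrightarrow> g z"
    and z: "z \<in> S"
  shows "(\<lambda>n. f n z) \<longlonglongrightarrow> g z"
proof (rule ccontr)
  assume "\<not> (\<lambda>n. f n z) \<longlonglongrightarrow> g z"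
  then obtain e where e: "e > 0" "\<exists>\<^sub>\<infinity>n. dist (f n z) (g z) \<ge> e"
    by (auto simp: tendsto_iff not_eventually not_less cofinite_eq_sequentially)
  then have "infinite {n. dist (f n z) (g z) \<ge> e}"
    by (simp add: INFM_iff_infinite)
  from infinite_enumerate[OF this] obtain r :: "nat \<Rightarrow> nat"
    where r: "strict_mono r" "\<And>n. dist (f (r n) z) (g z) \<ge> e"
    by blast
  have range: "range (\<lambda>n. f (r n)) \<subseteq> range f"
    by auto
  obtain h q where h: "h holomorphic_on S" "strict_mono (q :: nat \<Rightarrow> nat)"
    and lim: "\<And>x. x \<in> S \<Longrightarrow> (\<lambda>n. f (r (q n)) x) \<longlonglongrightarrow> h x"
  proof (rule Montel[OF S(1) _ _ range])
    show "\<exists>C. \<forall>h\<in>range f. \<forall>z\<in>K. norm (h z) \<le> C" if "compact K" "K \<subseteq> S" for K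
      using bounded[OF that] by auto
  qed (use hol(1) in auto)
  have "h w = g w" if "w \<in> U" for w
  proof -
    have "(\<lambda>n. f (r (q n)) w) \<longlonglongrightarrow> g w"
      using LIMSEQ_subseq_LIMSEQ[OF conv[OF that] strict_mono_o[OF r(1) h(2)]] by (simp add: o_def)
    with lim[of w] that U show ?thesis
      using LIMSEQ_unique by blast
  qed
  then have "h z - g z = 0"
    using analytic_continuation[of "\<lambda>w. h w - g w" S U \<xi> z] S U z h hol(2)
    by (auto intro!: holomorphic_intros)
  then have "(\<lambda>n. f (r (q n)) z) \<longlonglongrightarrow> g z"
    using lim[OF z] by simp
  then have "\<forall>\<^sub>F n in sequentially. dist (f (r (q n)) z) (g z) < e"
    using e(1) by (auto simp: tendsto_iff)
  with r(2) show False
    by (auto simp: eventually_sequentially not_less[symmetric])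
qed

section \<open>The exponential series and its bounds in a sector\<close>

definition growth :: "real \<Rightarrow> real \<Rightarrow> real \<Rightarrow> real \<Rightarrow> real" where
  "growth \<alpha> \<beta> \<gamma> t = ln (1 / t) powr \<alpha> * t powr \<beta> * exp (\<gamma> / t)"

lemma growth_pos: "0 < t \<Longrightarrow> t < 1 \<Longrightarrow> growth \<alpha> \<beta> \<gamma> t > 0"
  by (simp add: growth_def)

lemma growth_ratio:
  assumes "0 < x" "x < 1" "0 < r" "x * r < 1"
  shows "growth \<alpha> \<beta> \<gamma> (x * r) / growth \<alpha> \<beta> \<gamma> x
    = (ln (1 / (x * r)) / ln (1 / x)) powr \<alpha> * r powr \<beta> * exp (\<gamma> / (x * r) - \<gamma> / x)"
proof -
  define A where "A = ln (1 / (x * r))"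
  define B where "B = ln (1 / x)"
  have AB: "A > 0" "B > 0"
    unfolding A_def B_def using assms by (auto intro!: ln_gt_zero)
  have "(A / B) powr \<alpha> = A powr \<alpha> / B powr \<alpha>"
    using AB by (simp add: powr_divide)
  moreover have "(x * r) powr \<beta> = x powr \<beta> * r powr \<beta>"
    using assms by (simp add: powr_mult)
  ultimately show ?thesis
    unfolding growth_def A_def[symmetric] B_def[symmetric] exp_diff using AB assms by simp
qed

text \<open>
A bound that covers both signs of the exponent, so that no case distinction on the signs of \<alpha> and \<beta> is
needed below.
\<close>

lemma powr_le_powr_abs:
  fixes R \<rho> a :: real
  assumes "1 \<le> R" "1 / R \<le> \<rho>" "\<rho> \<le> R"
  shows "\<rho> powr a \<le> R powr \<bar>a\<bar>"
proof (cases "a \<ge> 0")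
  case True
  have "0 \<le> \<rho>" using assms by (smt (verit) divide_nonneg_nonneg)
  with True assms show ?thesis
    by (simp add: powr_mono2)
next
  case False
  have "0 < \<rho>" using assms by (smt (verit) divide_pos_pos)
  have "\<rho> powr a \<le> (1 / R) powr a"
    using False assms by (intro powr_mono2') auto
  also have "\<dots> = R powr \<bar>a\<bar>"
    using False assms by (simp add: powr_divide powr_minus_divide)
  finally show ?thesis .
qed

lemma suminf_exp_of_real:
  fixes b :: "nat \<Rightarrow> real"
  assumes "summable (\<lambda>n. b n * exp (- (x * real n)))"
  shows "(\<Sum>n. complex_of_real (b n) * exp (- (of_real x * of_nat n)))
    = of_real (\<Sum>n. b n * exp (- (x * real n)))"
proof -
  have "(\<lambda>n. complex_of_real (b n * exp (- (x * real n)))) sums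
      complex_of_real (\<Sum>n. b n * exp (- (x * real n)))"
    unfolding sums_of_real_iff using assms by (rule summable_sums)
  then show ?thesis
    by (simp add: sums_iff flip: exp_of_real)
qed

text \<open>
The hypotheses of the Tauberian theorem for a positive constant lam, in terms of the exponential series instead of
the power series. The sign condition on lam makes f eventually comparable to its growth function from below.
\<close>

locale ingham =
  fixes b :: "nat \<Rightarrow> real" and lam \<alpha> \<beta> \<gamma> :: real
    and f :: "real \<Rightarrow> real" and F :: "complex \<Rightarrow> complex"
  assumes f_def: "f = (\<lambda>x. \<Sum>n. b n * exp (- (x * real n)))"
    and F_def: "F = (\<lambda>z. \<Sum>n. complex_of_real (b n) * exp (- (z * of_nat n)))"
    and b_nonneg: "b n \<ge> 0"
    and summable_f: "x > 0 \<Longrightarrow> summable (\<lambda>n. b n * exp (- (x * real n)))"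
    and gamma_pos: "\<gamma> > 0" and lam_pos: "lam > 0"
    and radial: "((\<lambda>t. f t / growth \<alpha> \<beta> \<gamma> t) \<longlongrightarrow> lam) (at_right 0)"
    and angular: "\<Delta> > 0 \<Longrightarrow> \<exists>C d. d > 0 \<and> (\<forall>z. Re z > 0 \<longrightarrow> \<bar>Im z\<bar> \<le> \<Delta> * Re z \<longrightarrow> cmod z < d \<longrightarrow>
          cmod (F z) \<le> C * growth \<alpha> \<beta> \<gamma> (cmod z))"
begin

abbreviation "L \<equiv> growth \<alpha> \<beta> \<gamma>"

lemma summable_norm_F: "Re z > 0 \<Longrightarrow> summable (\<lambda>n. norm (complex_of_real (b n) * exp (- (z * of_nat n))))"
  using summable_f[of "Re z"] b_nonneg by (simp add: norm_mult)

lemma norm_F_le: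
  assumes "Re z > 0"
  shows "norm (F z) \<le> f (Re z)"
  unfolding F_def f_def using summable_norm[OF summable_norm_F[OF assms]] b_nonneg
  by (simp add: norm_mult)

lemma F_of_real: "x > 0 \<Longrightarrow> F (of_real x) = of_real (f x)"
  unfolding F_def f_def by (rule suminf_exp_of_real[OF summable_f])

text \<open>
F is a power series in exp (- z), and its radius of convergence is at least 1 because it converges at
exp (- x) for every x > 0.
\<close>

lemma holomorphic_F: "F holomorphic_on {z. Re z > 0}"
proof -
  define P where "P = (\<lambda>q. \<Sum>n. complex_of_real (b n) * q ^ n)"
  have "P holomorphic_on ball 0 1"
  proof (rule power_series_holomorphic)
    fix q :: complex assume q: "q \<in> ball 0 1"
    define x where "x = - ln ((norm q + 1) / 2)"
    have "0 < (norm q + 1) / 2" "(norm q + 1) / 2 < 1"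
      using q by (simp_all add: add_nonneg_pos)
    then have x: "x > 0" "exp (- x) = (norm q + 1) / 2"
      by (simp_all add: x_def ln_less_zero)
    have "summable (\<lambda>n. complex_of_real (b n) * q ^ n)"
    proof (rule summable_comparison_test'[OF summable_f[OF x(1)], of 0])
      fix n :: nat
      have "norm q ^ n \<le> exp (- x) ^ n"
        using q unfolding x by (intro power_mono) auto
      also have "\<dots> = exp (- (x * real n))"
        by (simp add: exp_of_nat2_mult[symmetric])
      finally show "norm (complex_of_real (b n) * q ^ n) \<le> b n * exp (- (x * real n))"
        using b_nonneg by (simp add: norm_mult norm_power mult_left_mono)
    qed
    then show "(\<lambda>n. complex_of_real (b n) * (q - 0) ^ n) sums P q"
      unfolding P_def by (simp add: summable_sums)
  qed
  then have "(\<lambda>z. P (exp (- z))) holomorphic_on {z. Re z > 0}"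
    by (intro holomorphic_on_compose_gen[of "\<lambda>z. exp (- z)" _ P, unfolded o_def])
       (auto intro!: holomorphic_intros)
  also have "(\<lambda>z. P (exp (- z))) = F"
    unfolding P_def F_def by (simp add: fun_eq_iff exp_of_nat2_mult[symmetric])
  finally show ?thesis .
qed

lemma f_eventually_ge: "\<exists>\<delta>>0. \<forall>x. 0 < x \<and> x < \<delta> \<longrightarrow> x < 1 \<and> f x \<ge> lam / 2 * L x"
proof -
  have "\<forall>\<^sub>F x in at_right 0. f x / L x > lam / 2"
    using radial lam_pos by (intro order_tendstoD) auto
  moreover have "\<forall>\<^sub>F x::real in at_right 0. x < 1"
    by (auto simp: eventually_at_right_field intro: exI[of _ 1])
  moreover have "\<forall>\<^sub>F x::real in at_right 0. x > 0"
    by (simp add: eventually_at_right_less)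
  ultimately have "\<forall>\<^sub>F x in at_right 0. x < 1 \<and> f x \<ge> lam / 2 * L x"
  proof eventually_elim
    case (elim x)
    with growth_pos[of x] show ?case
      by (simp add: field_simps less_imp_le)
  qed
  then show ?thesis
    by (auto simp: eventually_at_right_field)
qed

lemma f_pos: "x > 0 \<Longrightarrow> f x > 0"
proof -
  assume x: "x > 0"
  obtain \<delta> where d: "\<delta> > 0" "\<forall>x. 0 < x \<and> x < \<delta> \<longrightarrow> x < 1 \<and> f x \<ge> lam / 2 * L x"
    using f_eventually_ge by blast
  define y where "y = \<delta> / 2"
  have "0 < y" "y < \<delta>" using d(1) by (auto simp: y_def)
  with d(2) have "y < 1" "f y \<ge> lam / 2 * L y" by auto
  then have "f y > 0"
    using growth_pos[of y] lam_pos \<open>0 < y\<close> by (smt (verit) mult_pos_pos half_gt_zero)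
  have "\<exists>n. b n \<noteq> 0"
  proof (rule ccontr)
    assume "\<not> (\<exists>n. b n \<noteq> 0)"
    then have "f y = 0"
      by (simp add: f_def)
    with \<open>f y > 0\<close> show False by simp
  qed
  then obtain n where "b n \<noteq> 0" by blast
  then have "b n > 0"
    using b_nonneg[of n] by simp
  then show "f x > 0"
    unfolding f_def using b_nonneg x by (intro suminf_pos2[OF summable_f, of _ n]) auto
qed

text \<open>
With r = sqrt (1 + u^2), the modulus of x (1 + i u) is x r. Passing from x to x r changes the factors
ln (1 / x) powr \<alpha> and x powr \<beta> only by bounded factors, whereas the exponent \<gamma> / x drops by
(\<gamma> / x) (1 - 1 / r), and 1 - 1 / r = u^2 / (r (r + 1)). This Gaussian decay in u / sqrt x is what makes
dominated convergence possible later.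
\<close>

lemma angular_gaussian_bound:
  assumes "\<Delta> > 0"
  shows "\<exists>C c \<delta>. C \<ge> 0 \<and> c > 0 \<and> \<delta> > 0 \<and> (\<forall>x u. 0 < x \<and> x < \<delta> \<and> \<bar>u\<bar> \<le> \<Delta> \<longrightarrow>
     cmod (F (Complex x (x * u))) \<le> C * exp (- (c * u\<^sup>2 / x)) * f x)"
proof -
  obtain C d where d: "d > 0"
    and C: "\<And>z. Re z > 0 \<Longrightarrow> \<bar>Im z\<bar> \<le> \<Delta> * Re z \<Longrightarrow> cmod z < d \<Longrightarrow> cmod (F z) \<le> C * L (cmod z)"
    using angular[OF assms] by blast
  obtain \<delta> where \<delta>: "\<delta> > 0" "\<And>x. 0 < x \<Longrightarrow> x < \<delta> \<Longrightarrow> x < 1" "\<And>x. 0 < x \<Longrightarrow> x < \<delta> \<Longrightarrow> f x \<ge> lam / 2 * L x"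
    using f_eventually_ge by blast
  define R where "R = sqrt (1 + \<Delta>\<^sup>2)"
  have R: "R > 1" using assms by (simp add: R_def)
  define c where "c = \<gamma> / (R * (R + 1))"
  have c: "c > 0" using R gamma_pos by (simp add: c_def)
  define C' where "C' = \<bar>C\<bar> * (2 / lam) * (2 powr \<bar>\<alpha>\<bar> * R powr \<bar>\<beta>\<bar>)"
  have "C' \<ge> 0" using lam_pos by (simp add: C'_def)
  \<comment> \<open>the bound 1 / R^2 ensures (x r)^2 \<le> x, hence ln (1 / (x r)) \<ge> ln (1 / x) / 2\<close>
  define \<delta>' where "\<delta>' = min \<delta> (min (d / R) (1 / R\<^sup>2))"
  have "\<delta>' > 0" using \<delta> d R by (simp add: \<delta>'_def)
  have "cmod (F (Complex x (x * u))) \<le> C' * exp (- (c * u\<^sup>2 / x)) * f x"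
    if x: "0 < x" "x < \<delta>'" and u: "\<bar>u\<bar> \<le> \<Delta>" for x u
  proof -
    define r where "r = sqrt (1 + u\<^sup>2)"
    have "u\<^sup>2 \<le> \<Delta>\<^sup>2" using u assms by (simp add: abs_le_square_iff[symmetric])
    then have r: "1 \<le> r" "r \<le> R"
      by (auto simp: r_def R_def)
    have r2: "r\<^sup>2 = 1 + u\<^sup>2" by (simp add: r_def)
    have norm: "cmod (Complex x (x * u)) = x * r"
    proof -
      have "x\<^sup>2 + (x * u)\<^sup>2 = x\<^sup>2 * (1 + u\<^sup>2)" by (simp add: algebra_simps)
      then show ?thesis using x by (simp add: cmod_def r_def real_sqrt_mult)
    qed
    have xd: "x < \<delta>" "x < d / R" "x < 1 / R\<^sup>2" "x < 1"
      using x \<delta>(2) by (auto simp: \<delta>'_def)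
    have "x * R < d" using xd R by (simp add: field_simps)
    moreover have "x * r \<le> x * R" using x r by simp
    ultimately have xr: "x * r < d" by linarith
    have xR: "x * R\<^sup>2 < 1" using xd R by (simp add: field_simps)
    have "(x * r)\<^sup>2 \<le> x"
    proof -
      have "(x * r)\<^sup>2 = x * (x * r\<^sup>2)" by (simp add: power2_eq_square)
      also have "r\<^sup>2 \<le> R\<^sup>2" using r by (intro power_mono) auto
      then have "x * r\<^sup>2 \<le> 1" using xR x by (smt (verit) mult_left_mono)
      then have "x * (x * r\<^sup>2) \<le> x * 1" using x by (intro mult_left_mono) auto
      finally show ?thesis by simp
    qed
    then have "(x * r)\<^sup>2 < 1" using xd by linarith
    then have xr1: "x * r < 1" using x r by (simp add: power_less_one_iff)
    have lnx: "ln (1 / x) > 0" using x xd by (intro ln_gt_zero) auto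
    have "ln ((x * r)\<^sup>2) \<le> ln x"
      using \<open>(x * r)\<^sup>2 \<le> x\<close> x r by (subst ln_le_cancel_iff) auto
    then have "2 * ln (x * r) \<le> ln x"
      using x r by (simp add: ln_realpow)
    then have "1 / 2 \<le> ln (1 / (x * r)) / ln (1 / x)"
      using lnx x r by (simp add: ln_div field_simps)
    moreover have "ln (1 / (x * r)) \<le> ln (1 / x)"
      using x r by (subst ln_le_cancel_iff) (auto simp: field_simps)
    then have "ln (1 / (x * r)) / ln (1 / x) \<le> 2"
      using lnx by (simp add: field_simps)
    ultimately have 1: "(ln (1 / (x * r)) / ln (1 / x)) powr \<alpha> \<le> 2 powr \<bar>\<alpha>\<bar>"
      by (intro powr_le_powr_abs) auto
    have "1 / R \<le> 1" using R by simp
    then have "1 / R \<le> r" using r by linarith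
    then have 2: "r powr \<beta> \<le> R powr \<bar>\<beta>\<bar>"
      using r R by (intro powr_le_powr_abs) auto
    have "1 - 1 / r = u\<^sup>2 / (r * (r + 1))"
    proof -
      have "u\<^sup>2 = (r - 1) * (r + 1)" using r2 by (simp add: power2_eq_square algebra_simps)
      then have "u\<^sup>2 / (r * (r + 1)) = (r - 1) / r" using r by simp
      then show ?thesis using r by (simp add: diff_divide_distrib)
    qed
    also have "\<dots> \<ge> u\<^sup>2 / (R * (R + 1))"
      using r R by (intro divide_left_mono mult_mono mult_pos_pos) auto
    finally have "(1 - 1 / r) * (\<gamma> / x) \<ge> u\<^sup>2 / (R * (R + 1)) * (\<gamma> / x)"
      using x gamma_pos by (intro mult_right_mono) auto
    moreover have "(1 - 1 / r) * (\<gamma> / x) = \<gamma> / x - \<gamma> / (x * r)"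
      by (simp add: algebra_simps)
    moreover have "u\<^sup>2 / (R * (R + 1)) * (\<gamma> / x) = c * u\<^sup>2 / x"
      by (simp add: c_def)
    ultimately have 3: "\<gamma> / (x * r) - \<gamma> / x \<le> - (c * u\<^sup>2 / x)"
      by linarith
    have "L (x * r) / L x \<le> (2 powr \<bar>\<alpha>\<bar> * R powr \<bar>\<beta>\<bar>) * exp (- (c * u\<^sup>2 / x))"
      unfolding growth_ratio[OF x(1) xd(4) less_le_trans[OF zero_less_one r(1)] xr1]
      using 1 2 3 by (intro mult_mono) auto
    moreover have Lx: "L x > 0" using growth_pos x xd by simp
    ultimately have L: "L (x * r) \<le> (2 powr \<bar>\<alpha>\<bar> * R powr \<bar>\<beta>\<bar>) * exp (- (c * u\<^sup>2 / x)) * L x"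
      by (simp add: field_simps)
    have fx: "L x \<le> 2 / lam * f x"
      using \<delta>(3)[of x] x xd lam_pos by (simp add: field_simps)
    have "L (x * r) > 0" using growth_pos x r xr1 by simp
    have "cmod (F (Complex x (x * u))) \<le> C * L (x * r)"
      using C[of "Complex x (x * u)"] norm xr x u by (simp add: abs_mult mult.commute)
    also have "\<dots> \<le> \<bar>C\<bar> * L (x * r)"
      using \<open>L (x * r) > 0\<close> by (intro mult_right_mono) auto
    also have "\<dots> \<le> \<bar>C\<bar> * ((2 powr \<bar>\<alpha>\<bar> * R powr \<bar>\<beta>\<bar>) * exp (- (c * u\<^sup>2 / x)) * L x)"
      using L by (intro mult_left_mono) auto
    also have "\<dots> \<le> \<bar>C\<bar> * ((2 powr \<bar>\<alpha>\<bar> * R powr \<bar>\<beta>\<bar>) * exp (- (c * u\<^sup>2 / x)) * (2 / lam * f x))"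
      using fx by (intro mult_left_mono) auto
    finally show ?thesis
      by (simp add: C'_def mult_ac)
  qed
  with \<open>C' \<ge> 0\<close> c \<open>\<delta>' > 0\<close> show ?thesis
    by blast
qed

end

section \<open>Gaussian limit of the tilted masses\<close>

text \<open>
With q = sqrt x and z = x r this reads \<gamma> / z - \<gamma> / x + \<gamma> s / sqrt x = \<gamma> s^2 / r: after the linear
term of the expansion of \<gamma> / z is removed, what remains is exactly the Gaussian exponent divided by r.
\<close>

lemma exponent_identity:
  fixes q r s g :: real
  assumes "q \<noteq> 0" "r \<noteq> 0" "r = 1 + q * s"
  shows "g * s\<^sup>2 / r = g / (q * q * r) - g / (q * q) + g * s / q"
proof -
  have "g / (q * q * r) - g / (q * q) = g * (1 - r) / (q * q * r)"
    using assms(1,2) by (simp add: right_diff_distrib diff_divide_distrib)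
  also have "1 - r = - (q * s)"
    using assms(3) by simp
  finally have 1: "g / (q * q * r) - g / (q * q) = - (g * s / (q * r))"
    using assms(1) by simp
  have "g * s / q = g * s * r / (q * r)"
    using assms(2) by simp
  also have "g * s * r = g * s + g * s * (q * s)"
    unfolding assms(3) by (simp add: distrib_left)
  also have "(g * s + g * s * (q * s)) / (q * r) = g * s / (q * r) + g * s\<^sup>2 / r"
    using assms(1) by (simp add: add_divide_distrib power2_eq_square)
  finally show ?thesis
    using 1 by simp
qed

context ingham
begin

text \<open>
The real moment generating functions of the tilted masses, centred at N = \<gamma> / x^2 and rescaled by
x powr (3 / 2). The point x r = x + x powr (3 / 2) s still tends to 0 with r tending to 1, so the radial
asymptotics apply to both f (x r) and f x.
\<close>

lemma tilted_mgf_limit: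
  assumes X: "\<And>n::nat. X n > 0" "X \<longlonglongrightarrow> 0"
  shows "(\<lambda>n. f (X n + X n * sqrt (X n) * s) / f (X n) * exp (\<gamma> * s / sqrt (X n))) \<longlonglongrightarrow> exp (\<gamma> * s\<^sup>2)"
proof -
  define h where "h n = sqrt (X n) * s" for n
  define r where "r n = 1 + h n" for n
  have sq0: "(\<lambda>n. sqrt (X n)) \<longlonglongrightarrow> 0"
    using tendsto_real_sqrt[OF X(2)] by simp
  have h0: "h \<longlonglongrightarrow> 0"
    unfolding h_def using tendsto_mult_left_zero[OF sq0] by simp
  have r1: "r \<longlonglongrightarrow> 1"
    unfolding r_def using tendsto_add[OF tendsto_const h0] by simp
  have Xr0: "(\<lambda>n. X n * r n) \<longlonglongrightarrow> 0"
    using tendsto_mult[OF X(2) r1] by simp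
  have ev: "\<forall>\<^sub>F n in sequentially. r n > 0 \<and> X n < 1 \<and> X n * r n < 1"
    using order_tendstoD(1)[OF r1, of 0] order_tendstoD(2)[OF X(2), of 1] order_tendstoD(2)[OF Xr0, of 1]
    by (simp add: eventually_conj_iff)
  have Xright: "filterlim X (at_right 0) sequentially"
    using X less_imp_neq[OF X(1)] by (auto simp: filterlim_at intro!: always_eventually)
  have Xrright: "filterlim (\<lambda>n. X n * r n) (at_right 0) sequentially"
    using Xr0 ev X(1) less_imp_neq[OF X(1)] by (auto simp: filterlim_at elim!: eventually_mono)
  have 1: "(\<lambda>n. f (X n) / L (X n)) \<longlonglongrightarrow> lam"
    by (rule filterlim_compose[OF radial Xright])
  have 2: "(\<lambda>n. f (X n * r n) / L (X n * r n)) \<longlonglongrightarrow> lam"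
    by (rule filterlim_compose[OF radial Xrright])
  have A: "(\<lambda>n. ln (1 / (X n * r n)) / ln (1 / X n)) \<longlonglongrightarrow> 1"
  proof -
    have "filterlim (\<lambda>n. ln (X n)) at_bot sequentially"
      by (rule filterlim_compose[OF ln_at_0 Xright])
    moreover have "(\<lambda>n. ln (r n)) \<longlonglongrightarrow> 0"
      using tendsto_ln[OF r1] by simp
    ultimately have "(\<lambda>n. ln (r n) / ln (X n)) \<longlonglongrightarrow> 0"
      using tendsto_divide_0[OF _ filterlim_at_bot_imp_at_infinity] by blast
    from tendsto_add[OF tendsto_const[of 1] this]
    have "(\<lambda>n. 1 + ln (r n) / ln (X n)) \<longlonglongrightarrow> 1" by simp
    then show ?thesis
    proof (rule Lim_transform_eventually)
      show "\<forall>\<^sub>F n in sequentially. 1 + ln (r n) / ln (X n) = ln (1 / (X n * r n)) / ln (1 / X n)"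
        using ev
      proof eventually_elim
        case (elim n)
        have "ln (X n) < 0"
          using elim X(1)[of n] by (simp add: ln_less_zero)
        with elim X(1)[of n] show ?case
          by (simp add: ln_div ln_mult field_simps)
      qed
    qed
  qed
  have expo: "(\<lambda>n. \<gamma> * s\<^sup>2 / r n) \<longlonglongrightarrow> \<gamma> * s\<^sup>2 / 1"
    by (intro tendsto_intros r1) auto
  have "(\<lambda>n. (f (X n * r n) / L (X n * r n)) / (f (X n) / L (X n)) *
      ((ln (1 / (X n * r n)) / ln (1 / X n)) powr \<alpha> * r n powr \<beta> * exp (\<gamma> * s\<^sup>2 / r n)))
     \<longlonglongrightarrow> lam / lam * (1 powr \<alpha> * 1 powr \<beta> * exp (\<gamma> * s\<^sup>2 / 1))"
    using lam_pos by (intro tendsto_intros 1 2 A r1 expo) auto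
  also have "lam / lam * (1 powr \<alpha> * 1 powr \<beta> * exp (\<gamma> * s\<^sup>2 / 1)) = exp (\<gamma> * s\<^sup>2)"
    using lam_pos by simp
  finally show ?thesis
  proof (rule Lim_transform_eventually)
    show "\<forall>\<^sub>F n in sequentially. (f (X n * r n) / L (X n * r n)) / (f (X n) / L (X n)) *
      ((ln (1 / (X n * r n)) / ln (1 / X n)) powr \<alpha> * r n powr \<beta> * exp (\<gamma> * s\<^sup>2 / r n))
      = f (X n + X n * sqrt (X n) * s) / f (X n) * exp (\<gamma> * s / sqrt (X n))"
      using ev
    proof eventually_elim
      case (elim n)
      have X0: "X n > 0" by (rule X)
      have L0: "L (X n * r n) > 0" "L (X n) > 0"
        using elim X0 by (auto intro!: growth_pos)
      have "sqrt (X n) * sqrt (X n) = X n" "sqrt (X n) \<noteq> 0" "r n \<noteq> 0"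
        using X0 elim by auto
      then have e: "\<gamma> * s\<^sup>2 / r n = \<gamma> / (X n * r n) - \<gamma> / X n + \<gamma> * s / sqrt (X n)"
        using exponent_identity[of "sqrt (X n)" "r n" s \<gamma>] by (simp add: r_def h_def)
      have "exp (\<gamma> * s\<^sup>2 / r n) = exp (\<gamma> / (X n * r n) - \<gamma> / X n) * exp (\<gamma> * s / sqrt (X n))"
        unfolding e by (rule exp_add)
      then have "(ln (1 / (X n * r n)) / ln (1 / X n)) powr \<alpha> * r n powr \<beta> * exp (\<gamma> * s\<^sup>2 / r n)
          = L (X n * r n) / L (X n) * exp (\<gamma> * s / sqrt (X n))"
        using growth_ratio[of "X n" "r n" \<alpha> \<beta> \<gamma>] elim X0 by (simp only: mult.assoc)
      moreover have "X n * r n = X n + X n * sqrt (X n) * s"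
        by (simp add: r_def h_def algebra_simps)
      ultimately show ?case
        using L0 by simp
    qed
  qed
qed

text \<open>
As a function of s the left side is a sum of exponentials with nonnegative coefficients, and exp (e s) is at most
exp (e R) + exp (- e R).
\<close>

lemma f_exp_le:
  assumes R: "\<bar>s\<bar> \<le> R" and pos: "x + d * R > 0" "x + d * (- R) > 0"
  shows "f (x + d * s) * exp (a * s) \<le> f (x + d * R) * exp (a * R) + f (x + d * (- R)) * exp (a * (- R))"
proof -
  let ?t = "\<lambda>s k. b k * exp (- ((x + d * s) * real k)) * exp (a * s)"
  have "\<bar>d * s\<bar> \<le> \<bar>d\<bar> * R"
    using R by (simp add: abs_mult mult_left_mono)
  moreover have "\<bar>d\<bar> * R = d * R \<or> \<bar>d\<bar> * R = - (d * R)"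
    by (auto simp: abs_if)
  moreover have "d * (- R) = - (d * R)"
    by simp
  ultimately have "x + d * s > 0"
    using pos by linarith
  then have sums: "?t s sums (f (x + d * s) * exp (a * s))"
    "?t R sums (f (x + d * R) * exp (a * R))" "?t (- R) sums (f (x + d * (- R)) * exp (a * (- R)))"
    unfolding f_def using pos by (auto intro!: sums_mult2 summable_sums summable_f)
  have "?t s k \<le> ?t R k + ?t (- R) k" for k
  proof -
    define e where "e = a - d * real k"
    have eq: "?t s k = b k * exp (- (x * real k)) * exp (e * s)" for s
    proof -
      have "exp (- ((x + d * s) * real k)) * exp (a * s) = exp (- (x * real k)) * exp (e * s)"
        unfolding exp_add[symmetric] by (simp add: e_def algebra_simps)
      then show ?thesis by (simp only: mult.assoc)
    qed
    have "\<bar>e * s\<bar> \<le> \<bar>e\<bar> * R"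
      using R by (simp add: abs_mult mult_left_mono)
    then have "e * s \<le> e * R \<or> e * s \<le> e * (- R)"
      by (cases "e \<ge> 0") auto
    then have "exp (e * s) \<le> exp (e * R) \<or> exp (e * s) \<le> exp (e * (- R))"
      by simp
    then have "exp (e * s) \<le> exp (e * R) + exp (e * (- R))"
      using exp_gt_zero[of "e * R"] exp_gt_zero[of "e * (- R)"] by linarith
    then have "b k * exp (- (x * real k)) * exp (e * s) \<le> b k * exp (- (x * real k)) * (exp (e * R) + exp (e * (- R)))"
      using b_nonneg[of k] by (intro mult_left_mono) auto
    then show ?thesis
      unfolding eq by (simp only: distrib_left)
  qed
  then show ?thesis
    using sums_le[OF _ sums(1) sums_add[OF sums(2,3)]] by simp
qed

text \<open>
The characteristic functions. In a complex disc the moment generating functions are bounded by their values at the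
two real end points, which converge, so Vitali's theorem carries the limit from the real axis to the
imaginary axis.
\<close>

lemma tilted_char_limit:
  assumes X: "\<And>n::nat. X n > 0" "X \<longlonglongrightarrow> 0"
  shows "(\<lambda>n. F (Complex (X n) (X n * (sqrt (X n) * s))) / f (X n) * iexp (\<gamma> * s / sqrt (X n)))
           \<longlonglongrightarrow> complex_of_real (exp (- (\<gamma> * s\<^sup>2)))"
proof -
  \<comment> \<open>any radius beyond the modulus of s works; N makes the whole disc map into the right half-plane\<close>
  define R where "R = \<bar>s\<bar> + 1"
  have R: "R > 0" by (simp add: R_def)
  define \<phi> where "\<phi> n w = F (of_real (X n) + of_real (X n * sqrt (X n)) * w) / of_real (f (X n))
      * exp (of_real (\<gamma> / sqrt (X n)) * w)" for n w
  have "(\<lambda>n. sqrt (X n) * R) \<longlonglongrightarrow> 0"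
    using tendsto_mult_left_zero[OF tendsto_real_sqrt[OF X(2), simplified]] by simp
  then have "\<forall>\<^sub>F n in sequentially. sqrt (X n) * R < 1"
    by (rule order_tendstoD) auto
  then obtain N where N: "\<And>n. n \<ge> N \<Longrightarrow> sqrt (X n) * R < 1"
    by (auto simp: eventually_sequentially)
  have Re_pos: "X n + X n * sqrt (X n) * Re w > 0" if "n \<ge> N" "cmod w \<le> R" for n w
  proof -
    have "- Re w \<le> R" using that(2) abs_Re_le_cmod[of w] by linarith
    then have "sqrt (X n) * - Re w \<le> sqrt (X n) * R"
      using X(1)[of n] by (intro mult_left_mono) (auto simp: less_imp_le)
    then have "1 + sqrt (X n) * Re w > 0" using N[OF that(1)] by simp
    then have "X n * (1 + sqrt (X n) * Re w) > 0" using X(1)[of n] by simp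
    then show ?thesis by (simp add: algebra_simps)
  qed
  have \<phi>_real: "\<phi> n (of_real y) = of_real (f (X n + X n * sqrt (X n) * y) / f (X n) * exp (\<gamma> * y / sqrt (X n)))"
    if "n \<ge> N" "\<bar>y\<bar> \<le> R" for n y
    unfolding \<phi>_def using F_of_real[of "X n + X n * sqrt (X n) * y"] Re_pos[OF that(1), of "of_real y"] that(2)
    by (simp add: exp_of_real[symmetric])
  define G where "G n = f (X n + X n * sqrt (X n) * R) / f (X n) * exp (\<gamma> * R / sqrt (X n))
        + f (X n + X n * sqrt (X n) * (- R)) / f (X n) * exp (\<gamma> * (- R) / sqrt (X n))" for n
  have \<phi>_bound: "norm (\<phi> n w) \<le> G n"
    if n: "n \<ge> N" and w: "cmod w \<le> R" for n w
  proof -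
    define x where "x = X n"
    have x: "x > 0" using X by (simp add: x_def)
    have "norm (\<phi> n w) = norm (F (of_real x + of_real (x * sqrt x) * w)) / f x * exp (\<gamma> / sqrt x * Re w)"
      unfolding \<phi>_def using f_pos[OF x] by (simp add: norm_mult norm_divide x_def)
    also have "\<dots> \<le> f (x + x * sqrt x * Re w) / f x * exp (\<gamma> / sqrt x * Re w)"
      using norm_F_le[of "of_real x + of_real (x * sqrt x) * w"] Re_pos[OF n w] f_pos[OF x]
      by (intro mult_right_mono divide_right_mono) (auto simp: x_def)
    also have "\<dots> = (f (x + x * sqrt x * Re w) * exp (\<gamma> / sqrt x * Re w)) / f x"
      by simp
    also have "\<dots> \<le> (f (x + x * sqrt x * R) * exp (\<gamma> / sqrt x * R) + f (x + x * sqrt x * (- R)) * exp (\<gamma> / sqrt x * (- R))) / f x"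
      using Re_pos[OF n, of "of_real R"] Re_pos[OF n, of "of_real (- R)"] R f_pos[OF x] w abs_Re_le_cmod[of w]
      by (intro divide_right_mono f_exp_le) (auto simp: x_def)
    finally show ?thesis
      by (simp add: x_def G_def add_divide_distrib)
  qed
  have "(\<lambda>n. \<phi> (n + N) (\<i> * s)) \<longlonglongrightarrow> exp (of_real \<gamma> * (\<i> * of_real s)\<^sup>2)"
  proof (rule vitali_convergence[where f = "\<lambda>n. \<phi> (n + N)" and g = "\<lambda>w. exp (of_real \<gamma> * w\<^sup>2)"
        and S = "ball 0 R" and U = "complex_of_real ` {-R<..<R}" and \<xi> = 0])
    show "open (ball (0::complex) R)" "connected (ball (0::complex) R)" by auto
    show "\<phi> (n + N) holomorphic_on ball 0 R" for n
    proof -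
      have "(\<lambda>w. F (of_real (X (n + N)) + of_real (X (n + N) * sqrt (X (n + N))) * w)) holomorphic_on ball 0 R"
        by (rule holomorphic_on_compose_gen[OF _ holomorphic_F, unfolded o_def])
           (use Re_pos[of "n + N"] in \<open>auto intro!: holomorphic_intros\<close>)
      then show ?thesis
        unfolding \<phi>_def using f_pos[OF X(1), of "n + N"] by (intro holomorphic_intros) auto
    qed
    show "(\<lambda>w. exp (of_real \<gamma> * w\<^sup>2)) holomorphic_on ball 0 R"
      by (intro holomorphic_intros)
    show "\<exists>C. \<forall>n. \<forall>z\<in>K. cmod (\<phi> (n + N) z) \<le> C" if "compact K" "K \<subseteq> ball 0 R" for K
    proof -
      have "convergent G"
        unfolding G_def using tendsto_add[OF tilted_mgf_limit[OF X] tilted_mgf_limit[OF X]]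
        by (rule convergentI)
      then obtain C where C: "norm (G n) \<le> C" for n
        using convergent_imp_Bseq[of G] unfolding Bseq_def by blast
      have "cmod (\<phi> (n + N) z) \<le> C" if "z \<in> K" for n z
        using \<phi>_bound[of "n + N" z] C[of "n + N"] that \<open>K \<subseteq> ball 0 R\<close> by force
      then show ?thesis by blast
    qed
    show "complex_of_real ` {-R<..<R} \<subseteq> ball 0 R"
      by auto
    show "0 \<in> ball (0::complex) R" using R by simp
    show "0 islimpt complex_of_real ` {-R<..<R}"
      unfolding islimpt_approachable
    proof safe
      fix e :: real assume "e > 0"
      then show "\<exists>z\<in>complex_of_real ` {-R<..<R}. z \<noteq> 0 \<and> dist z 0 < e"
        using R by (intro bexI[of _ "of_real (min e R / 2)"] imageI) (auto simp del: of_real_divide)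
    qed
    show "(\<lambda>n. \<phi> (n + N) w) \<longlonglongrightarrow> exp (of_real \<gamma> * w\<^sup>2)" if "w \<in> complex_of_real ` {-R<..<R}" for w
    proof -
      from that obtain y where y: "w = of_real y" "\<bar>y\<bar> \<le> R" by auto
      have "(\<lambda>n. complex_of_real (f (X (n + N) + X (n + N) * sqrt (X (n + N)) * y) / f (X (n + N)) * exp (\<gamma> * y / sqrt (X (n + N)))))
         \<longlonglongrightarrow> of_real (exp (\<gamma> * y\<^sup>2))"
        by (intro tendsto_of_real LIMSEQ_ignore_initial_segment[OF tilted_mgf_limit[OF X]])
      then show ?thesis
        unfolding y(1) using \<phi>_real[OF _ y(2)] by (simp add: exp_of_real[symmetric])
    qed
    show "\<i> * of_real s \<in> ball 0 R" by (simp add: R_def norm_mult)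
  qed
  then have "(\<lambda>n. \<phi> n (\<i> * s)) \<longlonglongrightarrow> exp (of_real \<gamma> * (\<i> * of_real s)\<^sup>2)"
    by (rule LIMSEQ_offset)
  moreover have "\<phi> n (\<i> * s) = F (Complex (X n) (X n * (sqrt (X n) * s))) / f (X n) * iexp (\<gamma> * s / sqrt (X n))" for n
    by (simp add: \<phi>_def Complex_eq algebra_simps)
  moreover have "exp (of_real \<gamma> * (\<i> * of_real s)\<^sup>2) = complex_of_real (exp (- (\<gamma> * s\<^sup>2)))"
    by (simp add: power_mult_distrib exp_of_real[symmetric])
  ultimately show ?thesis
    by simp
qed

end

section \<open>Fourier transforms of the weighted tilted measures\<close>

lemma has_bochner_integral_gaussian:
  assumes "\<gamma> > 0"
  shows "has_bochner_integral lborel (\<lambda>s. exp (- (\<gamma> * s\<^sup>2))) (sqrt (pi / \<gamma>))"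
proof -
  have "has_bochner_integral lborel (\<lambda>s::real. exp (- s\<^sup>2)) (2 *\<^sub>R (sqrt pi / 2))"
    by (rule has_bochner_integral_even_function[OF gaussian_moment_0]) simp
  then have "has_bochner_integral lborel (\<lambda>s. exp (- (0 + sqrt \<gamma> * s)\<^sup>2)) ((2 *\<^sub>R (sqrt pi / 2)) /\<^sub>R \<bar>sqrt \<gamma>\<bar>)"
    using assms by (subst lborel_has_bochner_integral_real_affine_iff[symmetric]) auto
  moreover have "(2 *\<^sub>R (sqrt pi / 2)) /\<^sub>R \<bar>sqrt \<gamma>\<bar> = sqrt (pi / \<gamma>)"
    using assms by (simp add: real_sqrt_divide inverse_eq_divide)
  moreover have "(0 + sqrt \<gamma> * s)\<^sup>2 = \<gamma> * s\<^sup>2" for s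
    using assms by (simp add: power_mult_distrib)
  ultimately show ?thesis
    by (simp only:)
qed

context ingham
begin

text \<open>
Insert the representation of the weight as the Fourier integral of weight_hat and exchange sum and integral. Each
term has modulus b k * exp (- x k) * \<bar>weight_hat u\<bar>, which gives absolute convergence.
\<close>

lemma sums_weighted_iexp:
  assumes x: "x > 0"
  shows "(\<lambda>k. (b k * exp (- (x * real k)) * weight (x * (real k - p))) *\<^sub>R iexp (t * (x * (real k - p))))
     sums (LBINT u. weight_hat u *\<^sub>R (F (Complex x (- (x * (u + t)))) * iexp (- (x * p * (u + t)))))"
proof -
  define a where "a k = b k * exp (- (x * real k))" for k
  define v where "v k = x * (real k - p)" for k
  have a0: "a k \<ge> 0" for k using b_nonneg by (simp add: a_def)
  have suma: "summable a" unfolding a_def by (rule summable_f[OF x])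
  define T where "T k u = a k *\<^sub>R (iexp (t * v k) * (weight_hat u *\<^sub>R iexp (v k * u)))" for k u
  have T: "has_bochner_integral lborel (T k) ((a k * weight (v k)) *\<^sub>R iexp (t * v k))" for k
  proof -
    have "has_bochner_integral lborel (T k) (a k *\<^sub>R (iexp (t * v k) * complex_of_real (weight (v k))))"
      unfolding T_def
      by (intro has_bochner_integral_scaleR_right has_bochner_integral_mult_right has_bochner_integral_weight_hat_iexp)
    then show ?thesis by (simp add: scaleR_conv_of_real mult_ac)
  qed
  have normT: "norm (T k u) = a k * \<bar>weight_hat u\<bar>" for k u
    using a0[of k] by (simp add: T_def norm_mult abs_mult)
  have "(\<lambda>k. integral\<^sup>L lborel (T k)) sums (LBINT u. (\<Sum>k. T k u))"
  proof (rule sums_integral)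
    show "integrable lborel (T k)" for k
      using T by (rule integrable.intros)
    show "AE u in lborel. summable (\<lambda>k. norm (T k u))"
      unfolding normT using suma by (intro always_eventually allI summable_mult2)
    show "summable (\<lambda>k. LBINT u. norm (T k u))"
      unfolding normT using suma by (simp add: summable_mult2)
  qed
  also have "(\<lambda>k. integral\<^sup>L lborel (T k)) = (\<lambda>k. (a k * weight (v k)) *\<^sub>R iexp (t * v k))"
    using T by (simp add: has_bochner_integral_iff)
  also have "(\<lambda>u. \<Sum>k. T k u) = (\<lambda>u. weight_hat u *\<^sub>R (F (Complex x (- (x * (u + t)))) * iexp (- (x * p * (u + t)))))"
  proof
    fix u
    let ?z = "Complex x (- (x * (u + t)))"
    have "(\<lambda>k. complex_of_real (b k) * exp (- (?z * of_nat k))) sums F ?z"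
      unfolding F_def using x
      by (intro summable_sums[OF summable_norm_cancel] summable_norm_F) simp
    then have "(\<lambda>k. weight_hat u *\<^sub>R (complex_of_real (b k) * exp (- (?z * of_nat k)) * iexp (- (x * p * (u + t)))))
       sums (weight_hat u *\<^sub>R (F ?z * iexp (- (x * p * (u + t)))))"
      by (intro sums_scaleR_right sums_mult2)
    also have "(\<lambda>k. weight_hat u *\<^sub>R (complex_of_real (b k) * exp (- (?z * of_nat k)) * iexp (- (x * p * (u + t))))) = (\<lambda>k. T k u)"
    proof
      fix k
      have "exp (- (?z * of_nat k)) * iexp (- (x * p * (u + t)))
          = complex_of_real (exp (- (x * real k))) * (iexp (t * v k) * iexp (v k * u))"
        unfolding exp_of_real[symmetric] exp_add[symmetric]
        by (simp add: Complex_eq v_def algebra_simps)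
      then show "weight_hat u *\<^sub>R (complex_of_real (b k) * exp (- (?z * of_nat k)) * iexp (- (x * p * (u + t)))) = T k u"
        unfolding T_def a_def scaleR_conv_of_real of_real_mult mult.assoc by (simp only: ac_simps)
    qed
    finally show "(\<Sum>k. T k u) = weight_hat u *\<^sub>R (F ?z * iexp (- (x * p * (u + t))))"
      by (simp add: sums_iff)
  qed
  finally show ?thesis
    by (simp add: a_def v_def)
qed

text \<open>
After the substitution u = - t - sqrt x * s the integrand is weight_hat (t + sqrt x * s) times the characteristic
function of the tilted measure at s. It converges to weight_hat t * exp (- \<gamma> s^2); since weight_hat vanishes
outside [-1, 1], only points in the sector \<bar>Im z\<bar> \<le> (1 + \<bar>t\<bar>) Re z contribute, where the Gaussian bound
dominates.
\<close>

lemma weighted_iexp_limit: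
  assumes X: "\<And>n::nat. X n > 0" "X \<longlonglongrightarrow> 0"
  shows "(\<lambda>n. (\<Sum>k. (b k * exp (- (X n * real k)) * weight (X n * (real k - \<gamma> / (X n)\<^sup>2))) *\<^sub>R
            iexp (t * (X n * (real k - \<gamma> / (X n)\<^sup>2)))) / (f (X n) * sqrt (X n)))
           \<longlonglongrightarrow> complex_of_real (weight_hat t * sqrt (pi / \<gamma>))"
proof -
  define G where "G n s = weight_hat (t + sqrt (X n) * s) *\<^sub>R
      (F (Complex (X n) (X n * (sqrt (X n) * s))) / f (X n) * iexp (\<gamma> * s / sqrt (X n)))" for n s
  have eq: "(\<Sum>k. (b k * exp (- (X n * real k)) * weight (X n * (real k - \<gamma> / (X n)\<^sup>2))) *\<^sub>R
            iexp (t * (X n * (real k - \<gamma> / (X n)\<^sup>2)))) / (f (X n) * sqrt (X n)) = integral\<^sup>L lborel (G n)" for n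
  proof -
    define x where "x = X n"
    define q where "q = sqrt x"
    have x: "x > 0" using X by (simp add: x_def)
    have q: "q > 0" "q * q = x" using x by (auto simp: q_def)
    let ?H = "\<lambda>u. weight_hat u *\<^sub>R (F (Complex x (- (x * (u + t)))) * iexp (- (x * (\<gamma> / x\<^sup>2) * (u + t))))"
    have "integral\<^sup>L lborel ?H = \<bar>- q\<bar> *\<^sub>R (LBINT s. ?H (- t + - q * s))"
      using q by (intro lborel_integral_real_affine) auto
    also have "(LBINT s. ?H (- t + - q * s)) = (LBINT s. G n s * f x)"
    proof (rule Bochner_Integration.integral_cong)
      fix s
      have "weight_hat (- t + - q * s) = weight_hat (t + q * s)"
        using weight_hat_minus[of "t + q * s"] by (simp add: algebra_simps)
      moreover have "- (x * (\<gamma> / x\<^sup>2) * ((- t + - q * s) + t)) = \<gamma> * s / q"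
        using q x unfolding power2_eq_square by (simp add: field_simps)
      ultimately show "?H (- t + - q * s) = G n s * f x"
        using f_pos[OF x] by (simp add: G_def x_def[symmetric] q_def[symmetric])
    qed simp
    also have "\<dots> = integral\<^sup>L lborel (G n) * f x"
      by simp
    finally have "integral\<^sup>L lborel ?H = q *\<^sub>R (integral\<^sup>L lborel (G n) * f x)"
      using q by simp
    then show ?thesis
      using sums_weighted_iexp[OF x, of "\<gamma> / x\<^sup>2" t] q f_pos[OF x]
      by (simp add: sums_iff x_def[symmetric] q_def[symmetric] scaleR_conv_of_real)
  qed
  obtain C c \<delta> where C: "C \<ge> 0" "c > 0" "\<delta> > 0"
    and bound: "\<And>x u. 0 < x \<Longrightarrow> x < \<delta> \<Longrightarrow> \<bar>u\<bar> \<le> 1 + \<bar>t\<bar> \<Longrightarrow>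
      cmod (F (Complex x (x * u))) \<le> C * exp (- (c * u\<^sup>2 / x)) * f x"
    using angular_gaussian_bound[of "1 + \<bar>t\<bar>"] by force
  have "\<forall>\<^sub>F n in sequentially. X n < \<delta>"
    using X(2) C(3) by (rule order_tendstoD)
  then obtain N where N: "\<And>n. n \<ge> N \<Longrightarrow> X n < \<delta>"
    by (auto simp: eventually_sequentially)
  have "(\<lambda>n. integral\<^sup>L lborel (G (n + N))) \<longlonglongrightarrow> (LBINT s. weight_hat t *\<^sub>R complex_of_real (exp (- (\<gamma> * s\<^sup>2))))"
  proof (rule integral_dominated_convergence)
    have "isCont (\<lambda>s. F (Complex (X n) (X n * (sqrt (X n) * s)))) s" for n s
    proof -
      have "continuous_on {z. Re z > 0} F"
        by (rule holomorphic_on_imp_continuous_on[OF holomorphic_F])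
      then have "isCont F (Complex (X n) (X n * (sqrt (X n) * s)))"
        using X(1)[of n] by (subst (asm) continuous_on_eq_continuous_at) (auto simp: open_halfspace_Re_gt)
      then show ?thesis
        by (rule isCont_o2[rotated]) (auto simp: Complex_eq intro!: continuous_intros)
    qed
    then have [measurable]: "(\<lambda>s. F (Complex (X n) (X n * (sqrt (X n) * s)))) \<in> borel_measurable borel" for n
      by (intro borel_measurable_continuous_onI continuous_at_imp_continuous_on) auto
    show "G (n + N) \<in> borel_measurable lborel" for n
      unfolding G_def by measurable
    show "(\<lambda>s. weight_hat t *\<^sub>R complex_of_real (exp (- (\<gamma> * s\<^sup>2)))) \<in> borel_measurable lborel"
      by measurable
    show "integrable lborel (\<lambda>s. 2 * C * exp (- (c * s\<^sup>2)))"
      using has_bochner_integral_gaussian[OF C(2)] by (simp add: has_bochner_integral_iff)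
    show "AE s in lborel. (\<lambda>n. G (n + N) s) \<longlonglongrightarrow> weight_hat t *\<^sub>R complex_of_real (exp (- (\<gamma> * s\<^sup>2)))"
    proof (intro always_eventually allI)
      fix s
      have "(\<lambda>n. t + sqrt (X n) * s) \<longlonglongrightarrow> t + sqrt 0 * s"
        by (intro tendsto_intros X(2))
      then have "(\<lambda>n. weight_hat (t + sqrt (X n) * s)) \<longlonglongrightarrow> weight_hat t"
        by (intro isCont_tendsto_compose[OF isCont_weight_hat]) simp
      then have "(\<lambda>n. G n s) \<longlonglongrightarrow> weight_hat t *\<^sub>R complex_of_real (exp (- (\<gamma> * s\<^sup>2)))"
        unfolding G_def by (intro tendsto_scaleR tilted_char_limit X)
      then show "(\<lambda>n. G (n + N) s) \<longlonglongrightarrow> weight_hat t *\<^sub>R complex_of_real (exp (- (\<gamma> * s\<^sup>2)))"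
        by (rule LIMSEQ_ignore_initial_segment)
    qed
    show "AE s in lborel. norm (G (n + N) s) \<le> 2 * C * exp (- (c * s\<^sup>2))" for n
    proof (intro always_eventually allI)
      fix s
      define x where "x = X (n + N)"
      have x: "x > 0" "x < \<delta>" using X N[of "n + N"] by (auto simp: x_def)
      show "norm (G (n + N) s) \<le> 2 * C * exp (- (c * s\<^sup>2))"
      proof (cases "\<bar>t + sqrt x * s\<bar> \<ge> 1")
        case True
        then show ?thesis using C(1) by (simp add: G_def x_def weight_hat_eq_0)
      next
        case False
        then have "\<bar>sqrt x * s\<bar> \<le> 1 + \<bar>t\<bar>" by linarith
        from bound[OF x this] have "cmod (F (Complex x (x * (sqrt x * s)))) \<le> C * exp (- (c * s\<^sup>2)) * f x"
          using x by (simp add: power_mult_distrib)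
        then have "cmod (F (Complex x (x * (sqrt x * s)))) / f x \<le> C * exp (- (c * s\<^sup>2))"
          using f_pos[OF x(1)] by (simp add: field_simps)
        then have "\<bar>weight_hat (t + sqrt x * s)\<bar> * (cmod (F (Complex x (x * (sqrt x * s)))) / f x) \<le> 2 * (C * exp (- (c * s\<^sup>2)))"
          using f_pos[OF x(1)] by (intro mult_mono abs_weight_hat_le) auto
        then show ?thesis
          using f_pos[OF x(1)] by (simp add: G_def x_def norm_mult norm_divide)
      qed
    qed
  qed
  then have "(\<lambda>n. integral\<^sup>L lborel (G n)) \<longlonglongrightarrow> (LBINT s. weight_hat t *\<^sub>R complex_of_real (exp (- (\<gamma> * s\<^sup>2))))"
    by (rule LIMSEQ_offset)
  also have "(LBINT s. weight_hat t *\<^sub>R complex_of_real (exp (- (\<gamma> * s\<^sup>2)))) = complex_of_real (weight_hat t * sqrt (pi / \<gamma>))"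
  proof -
    have "has_bochner_integral lborel (\<lambda>s. weight_hat t *\<^sub>R complex_of_real (exp (- (\<gamma> * s\<^sup>2))))
        (weight_hat t *\<^sub>R complex_of_real (sqrt (pi / \<gamma>)))"
      by (intro has_bochner_integral_scaleR_right has_bochner_integral_of_real
          has_bochner_integral_gaussian gamma_pos)
    from has_bochner_integral_integral_eq[OF this] show ?thesis
      by (simp only: scaleR_conv_of_real of_real_mult)
  qed
  finally show ?thesis
    unfolding eq .
qed

end

section \<open>The local limit theorem\<close>

lemma fejer_le_1: "fejer v \<le> 1"
proof (cases "v = 0")
  case False
  have "\<bar>sin (v / 2)\<bar>\<^sup>2 \<le> \<bar>v / 2\<bar>\<^sup>2"
    by (intro power_mono abs_sin_x_le_abs_x) auto
  then have "2 * (1 - cos v) \<le> v\<^sup>2"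
    using cos_double_sin[of "v / 2"] by (simp add: power_divide)
  with False show ?thesis
    by (simp add: fejer_def)
qed (simp add: fejer_def)

text \<open>
The probability measure with mass proportional to a k at the point v k; the points may coincide.
\<close>

definition atomic_distribution :: "(nat \<Rightarrow> real) \<Rightarrow> (nat \<Rightarrow> real) \<Rightarrow> real measure" where
  "atomic_distribution a v = distr (density (count_space UNIV) (\<lambda>k. ennreal (a k / suminf a))) borel v"

context
  fixes a v :: "nat \<Rightarrow> real"
  assumes a_nonneg: "\<And>k. a k \<ge> 0" and a_summable: "summable a" and a_pos: "suminf a > 0"
begin

lemma real_distribution_atomic: "real_distribution (atomic_distribution a v)"
proof -
  have "(\<lambda>k. a k / suminf a) sums 1"
    using sums_divide[OF summable_sums[OF a_summable], of "suminf a"] a_pos by simp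
  moreover have "a k / suminf a \<ge> 0" for k
    using a_nonneg a_pos by (simp add: less_imp_le)
  ultimately have "(\<Sum>k. ennreal (a k / suminf a)) = 1"
    by (subst suminf_ennreal2) (auto simp: sums_iff)
  then have "prob_space (density (count_space UNIV) (\<lambda>k. ennreal (a k / suminf a)))"
    by (intro prob_spaceI) (simp add: emeasure_density nn_integral_count_space_nat)
  then show ?thesis
    unfolding atomic_distribution_def by (rule prob_space.real_distribution_distr) simp
qed

lemma sums_integral_atomic:
  fixes g :: "real \<Rightarrow> 'b :: {banach, second_countable_topology}"
  assumes g: "g \<in> borel_measurable borel" "\<And>x. norm (g x) \<le> B"
  shows "(\<lambda>k. (a k / suminf a) *\<^sub>R g (v k)) sums integral\<^sup>L (atomic_distribution a v) g"
proof -
  have nonneg: "a k / suminf a \<ge> 0" for k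
    using a_nonneg a_pos by (simp add: less_imp_le)
  have "integrable (count_space UNIV) (\<lambda>k. (a k / suminf a) *\<^sub>R g (v k))"
    unfolding integrable_count_space_nat_iff
  proof (rule summable_comparison_test')
    show "summable (\<lambda>k. a k / suminf a * B)"
      by (intro summable_mult2 summable_divide a_summable)
    show "norm (norm ((a k / suminf a) *\<^sub>R g (v k))) \<le> a k / suminf a * B" if "k \<ge> 0" for k
    proof -
      have "\<bar>a k / suminf a\<bar> * norm (g (v k)) \<le> a k / suminf a * B"
        using nonneg[of k] g(2)[of "v k"] by (intro mult_mono) auto
      then show ?thesis by simp
    qed
  qed
  then have "(\<lambda>k. (a k / suminf a) *\<^sub>R g (v k)) sums (\<integral>k. (a k / suminf a) *\<^sub>R g (v k) \<partial>count_space UNIV)"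
    by (rule sums_integral_count_space_nat)
  also have "(\<integral>k. (a k / suminf a) *\<^sub>R g (v k) \<partial>count_space UNIV) = integral\<^sup>L (atomic_distribution a v) g"
    unfolding atomic_distribution_def using g nonneg
    by (simp add: integral_distr integral_density)
  finally show ?thesis .
qed

end

definition weight_distribution :: "real measure" where
  "weight_distribution = density lborel (\<lambda>v. ennreal (weight v / (4 * pi)))"

lemma has_bochner_integral_weight: "has_bochner_integral lborel weight (4 * pi)"
proof -
  have "has_bochner_integral lborel (\<lambda>v. Re (weight v *\<^sub>R iexp (0 * v))) (Re (complex_of_real (2 * pi * weight_hat 0)))"
    by (rule has_bochner_integral_Re[OF has_bochner_integral_weight_iexp])
  then show ?thesis
    by (simp add: weight_hat_def triangle_def)
qed

lemma integral_weight_distribution: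
  fixes g :: "real \<Rightarrow> 'b :: {banach, second_countable_topology}"
  assumes "g \<in> borel_measurable borel"
  shows "integral\<^sup>L weight_distribution g = (LBINT v. (weight v / (4 * pi)) *\<^sub>R g v)"
  unfolding weight_distribution_def using assms weight_pos
  by (intro integral_density) (auto intro!: always_eventually simp: less_imp_le)

lemma real_distribution_weight: "real_distribution weight_distribution"
proof -
  have "(\<integral>\<^sup>+v. ennreal (weight v / (4 * pi)) \<partial>lborel) = ennreal (LBINT v. weight v / (4 * pi))"
    using has_bochner_integral_weight weight_pos
    by (intro nn_integral_eq_integral) (auto simp: has_bochner_integral_iff less_imp_le)
  also have "(LBINT v. weight v / (4 * pi)) = 1"
    using has_bochner_integral_weight by (simp add: has_bochner_integral_iff)
  finally have "prob_space weight_distribution"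
    unfolding weight_distribution_def by (intro prob_spaceI) (simp add: emeasure_density)
  then show ?thesis
    by (simp add: real_distribution_def real_distribution_axioms_def weight_distribution_def)
qed

lemma char_weight_distribution: "char weight_distribution t = complex_of_real (weight_hat t / 2)"
proof -
  have "char weight_distribution t = (LBINT v. (weight v / (4 * pi)) *\<^sub>R iexp (t * v))"
    unfolding char_def by (intro integral_weight_distribution) measurable
  also have "\<dots> = (LBINT v. (1 / (4 * pi)) *\<^sub>R (weight v *\<^sub>R iexp (t * v)))"
    by (simp only: scaleR_scaleR) simp
  also have "\<dots> = (1 / (4 * pi)) *\<^sub>R complex_of_real (2 * pi * weight_hat t)"
    using has_bochner_integral_integral_eq[OF has_bochner_integral_weight_iexp]
    by (simp only: integral_scaleR_right)
  also have "\<dots> = complex_of_real (weight_hat t / 2)"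
    by (simp add: scaleR_conv_of_real)
  finally show ?thesis .
qed

context ingham
begin

lemma exists_b_pos: "\<exists>k. b k > 0"
proof (rule ccontr)
  assume "\<not> (\<exists>k. b k > 0)"
  then have "b k = 0" for k
    using b_nonneg[of k] by (simp add: not_less order_antisym)
  then have "f 1 = 0"
    by (simp add: f_def)
  with f_pos[of 1] show False
    by simp
qed

text \<open>
The characteristic functions of the normalised weighted measures converge to that of the probability measure with
density weight / (4 pi). Levy's theorem gives weak convergence, hence convergence of the integrals of g; the
total masses are the case t = 0 of the previous limit and undo the normalisation.
\<close>

lemma weighted_limit:
  fixes g :: "real \<Rightarrow> real"
  assumes X: "\<And>n::nat. X n > 0" "X \<longlonglongrightarrow> 0"
    and g: "g \<in> borel_measurable borel" "\<And>x. \<bar>g x\<bar> \<le> B" "finite {x. \<not> isCont g x}"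
  shows "(\<lambda>n. (\<Sum>k. b k * exp (- (X n * real k)) * weight (X n * (real k - \<gamma> / (X n)\<^sup>2)) *
            g (X n * (real k - \<gamma> / (X n)\<^sup>2))) / (f (X n) * sqrt (X n)))
           \<longlonglongrightarrow> (LBINT v. weight v * g v) / (2 * sqrt (pi * \<gamma>))"
proof -
  define v where "v n k = X n * (real k - \<gamma> / (X n)\<^sup>2)" for n k
  define a where "a n k = b k * exp (- (X n * real k)) * weight (v n k)" for n k
  define D where "D n = f (X n) * sqrt (X n)" for n
  have D: "D n > 0" for n
    using X(1)[of n] f_pos by (simp add: D_def)
  have weight_le: "weight y \<le> 2" for y
    unfolding weight_def using fejer_le_1[of "y - pi / 2"] fejer_le_1[of "y + pi / 2"] by linarith
  have a_nonneg: "a n k \<ge> 0" for n k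
    using b_nonneg weight_pos by (simp add: a_def less_imp_le)
  have a_summable: "summable (a n)" for n
  proof (rule summable_comparison_test')
    show "summable (\<lambda>k. b k * exp (- (X n * real k)) * 2)"
      by (intro summable_mult2 summable_f X)
    show "norm (a n k) \<le> b k * exp (- (X n * real k)) * 2" if "k \<ge> 0" for k
      using weight_le[of "v n k"] b_nonneg[of k] weight_pos[of "v n k"] by (simp add: a_def abs_mult mult_left_mono)
  qed
  have a_pos: "suminf (a n) > 0" for n
  proof -
    obtain k where "b k > 0"
      using exists_b_pos by blast
    then have "a n k > 0"
      using weight_pos by (simp add: a_def)
    then show ?thesis
      by (intro suminf_pos2[OF a_summable a_nonneg])
  qed
  have lim: "(\<lambda>n. (\<Sum>k. a n k *\<^sub>R iexp (t * v n k)) / D n) \<longlonglongrightarrow> complex_of_real (weight_hat t * sqrt (pi / \<gamma>))" for t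
    using weighted_iexp_limit[OF X, of t] by (simp add: a_def v_def D_def)
  have "(\<Sum>k. a n k *\<^sub>R iexp (0 * v n k)) = complex_of_real (suminf (a n))" for n
    using a_summable[of n] by (simp add: scaleR_conv_of_real suminf_of_real)
  with lim[of 0] have "(\<lambda>n. complex_of_real (suminf (a n) / D n)) \<longlonglongrightarrow> complex_of_real (weight_hat 0 * sqrt (pi / \<gamma>))"
    by simp
  then have total: "(\<lambda>n. suminf (a n) / D n) \<longlonglongrightarrow> 2 * sqrt (pi / \<gamma>)"
    by (simp only: tendsto_of_real_iff) (simp add: weight_hat_def triangle_def)
  define M where "M n = atomic_distribution (a n) (v n)" for n
  have M: "real_distribution (M n)" for n
    unfolding M_def by (intro real_distribution_atomic a_nonneg a_summable a_pos)
  have weak: "weak_conv_m M weight_distribution"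
  proof (rule levy_continuity[OF M real_distribution_weight])
    fix t
    have char: "char (M n) t = (\<Sum>k. a n k *\<^sub>R iexp (t * v n k)) / D n / complex_of_real (suminf (a n) / D n)" for n
    proof -
      have "(\<lambda>k. (a n k / suminf (a n)) *\<^sub>R iexp (t * v n k)) sums char (M n) t"
        unfolding char_def M_def
        by (intro sums_integral_atomic[where B = 1] a_nonneg a_summable a_pos) auto
      from sums_mult[OF this, of "complex_of_real (suminf (a n))"]
      have "(\<lambda>k. a n k *\<^sub>R iexp (t * v n k)) sums (suminf (a n) * char (M n) t)"
        using a_pos[of n] by (simp add: scaleR_conv_of_real)
      then show ?thesis
        using a_pos[of n] D[of n] by (simp add: sums_iff)
    qed
    have "(\<lambda>n. char (M n) t) \<longlonglongrightarrow> complex_of_real (weight_hat t * sqrt (pi / \<gamma>)) / complex_of_real (2 * sqrt (pi / \<gamma>))"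
      unfolding char using gamma_pos by (intro tendsto_divide lim tendsto_of_real total) auto
    then show "(\<lambda>n. char (M n) t) \<longlonglongrightarrow> char weight_distribution t"
      using gamma_pos by (simp add: char_weight_distribution)
  qed
  have "emeasure weight_distribution {x. \<not> isCont g x} = 0"
  proof -
    have "AE x in lborel. x \<notin> {x. \<not> isCont g x}"
      using finite_imp_null_set_lborel[OF g(3)] by (rule AE_not_in)
    then have "{x. \<not> isCont g x} \<in> null_sets weight_distribution"
      unfolding weight_distribution_def using borel_closed[OF finite_imp_closed[OF g(3)]]
      by (subst null_sets_density_iff) auto
    then show ?thesis by auto
  qed
  with weak have "(\<lambda>n. integral\<^sup>L (M n) g) \<longlonglongrightarrow> integral\<^sup>L weight_distribution g"
    using M real_distribution_weight g(1,2)
    by (intro weak_conv_imp_bdd_ae_continuous_conv[where B = B]) auto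
  from tendsto_mult[OF total this]
  have "(\<lambda>n. suminf (a n) / D n * integral\<^sup>L (M n) g) \<longlonglongrightarrow> 2 * sqrt (pi / \<gamma>) * integral\<^sup>L weight_distribution g" .
  also have "(\<lambda>n. suminf (a n) / D n * integral\<^sup>L (M n) g) = (\<lambda>n. (\<Sum>k. a n k * g (v n k)) / D n)"
  proof
    fix n
    have "(\<lambda>k. (a n k / suminf (a n)) *\<^sub>R g (v n k)) sums integral\<^sup>L (M n) g"
      unfolding M_def using g by (intro sums_integral_atomic[where B = B] a_nonneg a_summable a_pos) auto
    from sums_mult[OF this, of "suminf (a n)"]
    have "(\<lambda>k. a n k * g (v n k)) sums (suminf (a n) * integral\<^sup>L (M n) g)"
      using a_pos[of n] by simp
    then show "suminf (a n) / D n * integral\<^sup>L (M n) g = (\<Sum>k. a n k * g (v n k)) / D n"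
      by (simp add: sums_iff)
  qed
  also have "2 * sqrt (pi / \<gamma>) * integral\<^sup>L weight_distribution g = (LBINT v. weight v * g v) / (2 * sqrt (pi * \<gamma>))"
  proof -
    have "2 * sqrt (pi / \<gamma>) * integral\<^sup>L weight_distribution g
        = 2 * sqrt (pi / \<gamma>) / (4 * pi) * (LBINT v. weight v * g v)"
      by (simp add: integral_weight_distribution[OF g(1)])
    also have "2 * sqrt (pi / \<gamma>) / (4 * pi) = 1 / (2 * sqrt (pi * \<gamma>))"
      using gamma_pos by (simp add: real_sqrt_divide real_sqrt_mult field_simps)
    finally show ?thesis
      by simp
  qed
  finally show ?thesis
    by (simp add: a_def v_def D_def)
qed

text \<open>
Apply the weighted limit to h / weight, which is bounded and as continuous as h because the weight is continuous
and has no zeros.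
\<close>

lemma local_limit:
  fixes h :: "real \<Rightarrow> real"
  assumes X: "\<And>n::nat. X n > 0" "X \<longlonglongrightarrow> 0"
    and h: "h \<in> borel_measurable borel" "\<And>x. \<bar>h x\<bar> \<le> C * weight x" "finite {x. \<not> isCont h x}"
  shows "(\<lambda>n. (\<Sum>k. b k * exp (- (X n * real k)) * h (X n * (real k - \<gamma> / (X n)\<^sup>2))) / (f (X n) * sqrt (X n)))
           \<longlonglongrightarrow> integral\<^sup>L lborel h / (2 * sqrt (pi * \<gamma>))"
proof -
  have w0: "weight x \<noteq> 0" for x
    using weight_pos[of x] by simp
  have "\<bar>h x / weight x\<bar> \<le> C" for x
    using h(2)[of x] weight_pos[of x] by (simp add: abs_divide divide_le_eq)
  moreover have "isCont (\<lambda>x. h x / weight x) x" if "isCont h x" for x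
    using that isCont_weight w0 by (rule isCont_divide)
  then have "finite {x. \<not> isCont (\<lambda>x. h x / weight x) x}"
    by (intro finite_subset[OF _ h(3)]) auto
  moreover have "(\<lambda>x. h x / weight x) \<in> borel_measurable borel"
    using h(1) by measurable
  ultimately show ?thesis
    using weighted_limit[OF X, of "\<lambda>x. h x / weight x" C] w0 by (simp add: mult.assoc)
qed

end

section \<open>Partial sums and monotone coefficients\<close>

text \<open>
The exponential beats the quadratic decay of the weight: \<bar>v\<bar> + pi / 2 \<le> 2 + \<bar>v\<bar> \<le> 2 exp (\<bar>v\<bar> / 2).
\<close>

lemma exp_le_weight:
  assumes "v \<le> 0"
  shows "exp v \<le> weight v"
proof -
  have D: "\<bar>v\<bar> + pi / 2 > 0"
    using pi_gt_zero by linarith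
  have "(\<bar>v\<bar> + pi / 2)\<^sup>2 \<le> (2 * exp (\<bar>v\<bar> / 2))\<^sup>2"
  proof (rule power_mono)
    show "\<bar>v\<bar> + pi / 2 \<le> 2 * exp (\<bar>v\<bar> / 2)"
      using exp_ge_add_one_self[of "\<bar>v\<bar> / 2"] pi_less_4 by linarith
    show "0 \<le> \<bar>v\<bar> + pi / 2"
      using pi_gt_zero by linarith
  qed
  also have "(2 * exp (\<bar>v\<bar> / 2))\<^sup>2 = 4 * exp (- v)"
    using assms by (simp add: power_mult_distrib exp_double[symmetric])
  finally have "exp v * (\<bar>v\<bar> + pi / 2)\<^sup>2 \<le> exp v * (4 * exp (- v))"
    by (intro mult_left_mono) auto
  also have "\<dots> = 4"
    by (simp add: exp_minus)
  finally have "exp v \<le> 4 / (\<bar>v\<bar> + pi / 2)\<^sup>2"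
    using D by (simp add: pos_le_divide_eq)
  then show ?thesis
    using weight_lower[of v] by linarith
qed

lemma indicator_le_weight:
  "\<bar>indicator {p..q} v\<bar> \<le> ((\<bar>p\<bar> + \<bar>q\<bar> + 2)\<^sup>2 / 4) * weight v"
proof (cases "v \<in> {p..q}")
  case True
  have D: "\<bar>v\<bar> + pi / 2 > 0"
    using pi_gt_zero by linarith
  have "(\<bar>v\<bar> + pi / 2)\<^sup>2 \<le> (\<bar>p\<bar> + \<bar>q\<bar> + 2)\<^sup>2"
    using True pi_less_4 D by (intro power_mono) auto
  then have "1 \<le> (\<bar>p\<bar> + \<bar>q\<bar> + 2)\<^sup>2 / (\<bar>v\<bar> + pi / 2)\<^sup>2"
    using D by (subst pos_le_divide_eq) auto
  also have "\<dots> = ((\<bar>p\<bar> + \<bar>q\<bar> + 2)\<^sup>2 / 4) * (4 / (\<bar>v\<bar> + pi / 2)\<^sup>2)"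
    by simp
  also have "\<dots> \<le> ((\<bar>p\<bar> + \<bar>q\<bar> + 2)\<^sup>2 / 4) * weight v"
    by (intro mult_left_mono weight_lower) auto
  finally show ?thesis
    using True by simp
qed (use weight_pos in \<open>simp add: less_imp_le\<close>)

lemma finite_window:
  fixes x c q :: real
  assumes "x > 0"
  shows "finite {k :: nat. x * (real k - c) \<in> {p..q}}"
proof (rule finite_subset)
  show "{k :: nat. x * (real k - c) \<in> {p..q}} \<subseteq> {..nat \<lceil>c + q / x\<rceil>}"
  proof
    fix k :: nat assume "k \<in> {k. x * (real k - c) \<in> {p..q}}"
    then have "real k \<le> c + q / x"
      using assms by (simp add: field_simps)
    then show "k \<in> {..nat \<lceil>c + q / x\<rceil>}"
      by simp linarith
  qed
qed simp

context ingham
begin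

text \<open>
The test function exp v on v \<le> 0, at v = x (k - N), turns exp (- x k) into the constant exp (- x N) on k \<le> N; its
integral is 1.
\<close>

lemma partial_sum_limit:
  assumes X: "\<And>n::nat. X n > 0" "X \<longlonglongrightarrow> 0" and N: "\<And>n. \<gamma> / (X n)\<^sup>2 = real (N n)"
  shows "(\<lambda>n. (\<Sum>k\<le>N n. b k) * exp (- (X n * real (N n))) / (f (X n) * sqrt (X n)))
           \<longlonglongrightarrow> 1 / (2 * sqrt (pi * \<gamma>))"
proof -
  define h :: "real \<Rightarrow> real" where "h v = indicator {..0} v * exp v" for v
  have "isCont h v" if "v \<noteq> 0" for v
    unfolding h_def using that by (intro continuous_intros) (auto simp: isCont_indicator)
  then have "{v. \<not> isCont h v} \<subseteq> {0}"
    by blast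
  then have "finite {v. \<not> isCont h v}"
    by (rule finite_subset) simp
  moreover have "h \<in> borel_measurable borel"
    unfolding h_def by measurable
  moreover have "\<bar>h v\<bar> \<le> 1 * weight v" for v
    using exp_le_weight[of v] weight_pos[of v] by (simp add: h_def indicator_def less_imp_le)
  ultimately have "(\<lambda>n. (\<Sum>k. b k * exp (- (X n * real k)) * h (X n * (real k - \<gamma> / (X n)\<^sup>2))) / (f (X n) * sqrt (X n)))
           \<longlonglongrightarrow> integral\<^sup>L lborel h / (2 * sqrt (pi * \<gamma>))"
    by (intro local_limit[where h = h and C = 1, OF X])
  also have "integral\<^sup>L lborel h = 1"
  proof -
    let ?e = "\<lambda>x::real. x ^ 0 * exp (- x) * indicator {0..} x"
    have "has_bochner_integral lborel (\<lambda>x. ?e (0 + - 1 * x)) (fact 0 /\<^sub>R \<bar>- 1\<bar>)"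
      by (rule iffD1[OF lborel_has_bochner_integral_real_affine_iff[of "- 1" ?e "fact 0" 0]])
         (simp, rule has_bochner_integral_I0i_power_exp_m')
    also have "(\<lambda>x. (0 + - 1 * x) ^ 0 * exp (- (0 + - 1 * x)) * indicator {0..} (0 + - 1 * x)) = h"
      by (auto simp: h_def fun_eq_iff indicator_def)
    finally show ?thesis
      by (simp add: has_bochner_integral_iff)
  qed
  moreover have "(\<Sum>k. b k * exp (- (X n * real k)) * h (X n * (real k - \<gamma> / (X n)\<^sup>2)))
      = (\<Sum>k\<le>N n. b k) * exp (- (X n * real (N n)))" for n
  proof -
    have 1: "b k * exp (- (X n * real k)) * h (X n * (real k - real (N n))) = b k * exp (- (X n * real (N n)))"
      if "k \<le> N n" for k
    proof -
      have "X n * (real k - real (N n)) \<le> 0"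
        using that X(1)[of n] by (intro mult_nonneg_nonpos) (auto simp: less_imp_le)
      moreover have "exp (- (X n * real k)) * exp (X n * (real k - real (N n))) = exp (- (X n * real (N n)))"
        unfolding exp_add[symmetric] by (simp add: right_diff_distrib)
      ultimately show ?thesis
        by (simp add: h_def mult.assoc)
    qed
    have 2: "b k * exp (- (X n * real k)) * h (X n * (real k - real (N n))) = 0" if "k \<notin> {..N n}" for k
    proof -
      have "X n * (real k - real (N n)) > 0"
        using that X(1)[of n] by (intro mult_pos_pos) auto
      then show ?thesis
        by (simp add: h_def)
    qed
    have "(\<Sum>k. b k * exp (- (X n * real k)) * h (X n * (real k - \<gamma> / (X n)\<^sup>2)))
        = (\<Sum>k\<le>N n. b k * exp (- (X n * real k)) * h (X n * (real k - real (N n))))"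
      unfolding N by (rule suminf_finite) (use 2 in auto)
    also have "\<dots> = (\<Sum>k\<le>N n. b k * exp (- (X n * real (N n))))"
      by (intro sum.cong refl 1) auto
    finally show ?thesis
      by (simp add: sum_distrib_right)
  qed
  ultimately show ?thesis
    by (simp only:)
qed

lemma window_limit:
  assumes X: "\<And>n::nat. X n > 0" "X \<longlonglongrightarrow> 0" and N: "\<And>n. \<gamma> / (X n)\<^sup>2 = real (N n)"
    and pq: "p \<le> q"
  shows "(\<lambda>n. (\<Sum>k | X n * (real k - real (N n)) \<in> {p..q}. b k * exp (- (X n * real k))) / (f (X n) * sqrt (X n)))
           \<longlonglongrightarrow> (q - p) / (2 * sqrt (pi * \<gamma>))"
proof -
  have "isCont (indicator {p..q} :: real \<Rightarrow> real) v" if "v \<notin> {p, q}" for v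
    using that pq by (auto simp: isCont_indicator frontier_def)
  then have "{v. \<not> isCont (indicator {p..q} :: real \<Rightarrow> real) v} \<subseteq> {p, q}"
    by blast
  then have "finite {v. \<not> isCont (indicator {p..q} :: real \<Rightarrow> real) v}"
    by (rule finite_subset) simp
  then have "(\<lambda>n. (\<Sum>k. b k * exp (- (X n * real k)) * indicator {p..q} (X n * (real k - \<gamma> / (X n)\<^sup>2))) / (f (X n) * sqrt (X n)))
           \<longlonglongrightarrow> integral\<^sup>L lborel (indicator {p..q}) / (2 * sqrt (pi * \<gamma>))"
    by (intro local_limit[where h = "indicator {p..q}", OF X _ indicator_le_weight]) measurable
  also have "integral\<^sup>L lborel (indicator {p..q}) = q - p"
    using pq by simp
  moreover have "(\<Sum>k. b k * exp (- (X n * real k)) * indicator {p..q} (X n * (real k - \<gamma> / (X n)\<^sup>2)))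
     = (\<Sum>k | X n * (real k - real (N n)) \<in> {p..q}. b k * exp (- (X n * real k)))" for n
  proof -
    let ?A = "{k. X n * (real k - real (N n)) \<in> {p..q}}"
    have fin: "finite ?A"
      by (rule finite_window[OF X(1)])
    have "(\<Sum>k. b k * exp (- (X n * real k)) * indicator {p..q} (X n * (real k - \<gamma> / (X n)\<^sup>2)))
        = (\<Sum>k\<in>?A. b k * exp (- (X n * real k)) * indicator {p..q} (X n * (real k - real (N n))))"
      unfolding N by (rule suminf_finite[OF fin]) auto
    also have "\<dots> = (\<Sum>k\<in>?A. b k * exp (- (X n * real k)))"
      by (intro sum.cong refl) auto
    finally show ?thesis .
  qed
  ultimately show ?thesis
    by (simp only:)
qed

text \<open>
A window of length d at the scale 1 / x contains about d / x indices. On the window to the right of N every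
coefficient is at least b N, on the one to the left at most b N, and exp (- x k) varies by at most a factor
exp d. So the limit is bounded by exp d and exp (- d) times the constant for every d > 0.
\<close>

lemma coefficient_limit:
  assumes X: "\<And>n::nat. X n > 0" "X \<longlonglongrightarrow> 0" and N: "\<And>n. \<gamma> / (X n)\<^sup>2 = real (N n)"
    and mono: "mono b"
  shows "(\<lambda>n. b (N n) * exp (- (X n * real (N n))) / (X n * (f (X n) * sqrt (X n))))
           \<longlonglongrightarrow> 1 / (2 * sqrt (pi * \<gamma>))"
proof -
  define \<kappa> where "\<kappa> = 1 / (2 * sqrt (pi * \<gamma>))"
  define T where "T n = f (X n) * sqrt (X n)" for n
  define U where "U n = b (N n) * exp (- (X n * real (N n))) / (X n * T n)" for n
  define W where "W p q n = (\<Sum>k | X n * (real k - real (N n)) \<in> {p..q}. b k * exp (- (X n * real k))) / T n" for p q n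
  have T: "T n > 0" for n
    using X(1)[of n] f_pos by (simp add: T_def)
  have W: "W p q \<longlonglongrightarrow> (q - p) * \<kappa>" if "p \<le> q" for p q
    using window_limit[OF X N that] by (simp add: W_def[abs_def] T_def \<kappa>_def)
  have fin: "finite {k. X n * (real k - real (N n)) \<in> {p..q}}" for p q n
    by (rule finite_window[OF X(1)])
  have upper: "U n \<le> exp d / d * W 0 d n" if d: "d > 0" for d n
  proof -
    \<comment> \<open>the window contains the m + 1 indices from N n to N n + m, and m + 1 is at least d / X n\<close>
    define m where "m = nat \<lfloor>d / X n\<rfloor>"
    have X0: "X n > 0" by (rule X)
    have m: "real m \<le> d / X n" "d / X n \<le> real m + 1"
      using d X0 by (auto simp: m_def)
    have "b (N n) * exp (- (X n * real (N n)) - d) * (d / X n) \<le> b (N n) * exp (- (X n * real (N n)) - d) * (real m + 1)"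
      using m b_nonneg by (intro mult_left_mono) auto
    also have "\<dots> = (\<Sum>k\<in>{N n..N n + m}. b (N n) * exp (- (X n * real (N n)) - d))"
      by simp
    also have "\<dots> \<le> (\<Sum>k\<in>{N n..N n + m}. b k * exp (- (X n * real k)))"
    proof (rule sum_mono)
      fix k assume k: "k \<in> {N n..N n + m}"
      have "X n * (real k - real (N n)) \<le> X n * real m"
        using k X0 by (intro mult_left_mono) auto
      also have "\<dots> \<le> d"
        using m(1) X0 by (simp add: field_simps)
      finally have "- (X n * real (N n)) - d \<le> - (X n * real k)"
        by (simp add: right_diff_distrib)
      then show "b (N n) * exp (- (X n * real (N n)) - d) \<le> b k * exp (- (X n * real k))"
        using k monoD[OF mono, of "N n" k] b_nonneg by (intro mult_mono) auto
    qed
    also have "\<dots> \<le> (\<Sum>k | X n * (real k - real (N n)) \<in> {0..d}. b k * exp (- (X n * real k)))"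
    proof (rule sum_mono2[OF fin])
      show "{N n..N n + m} \<subseteq> {k. X n * (real k - real (N n)) \<in> {0..d}}"
      proof
        fix k assume k: "k \<in> {N n..N n + m}"
        have "X n * (real k - real (N n)) \<le> X n * real m"
          using k X0 by (intro mult_left_mono) auto
        also have "\<dots> \<le> d"
          using m(1) X0 by (simp add: field_simps)
        finally show "k \<in> {k. X n * (real k - real (N n)) \<in> {0..d}}"
          using k X0 by simp
      qed
    qed (use b_nonneg in auto)
    also have "\<dots> = T n * W 0 d n"
      using T[of n] by (simp add: W_def)
    also have "b (N n) * exp (- (X n * real (N n)) - d) * (d / X n) = T n * (U n * (d / exp d))"
      using T[of n] X0 by (simp add: U_def exp_diff mult_ac)
    finally have "U n * (d / exp d) \<le> W 0 d n"
      using mult_le_cancel_left_pos[OF T[of n]] by blast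
    then show ?thesis
      using d by (simp add: field_simps)
  qed
  have lower: "exp (- d) / (d + X n) * W (- d) 0 n \<le> U n" if d: "d > 0" for d n
  proof -
    \<comment> \<open>the window lies within N n - m, ..., N n, where the truncated difference only shrinks the range\<close>
    define m where "m = nat \<lfloor>d / X n\<rfloor>"
    have X0: "X n > 0" by (rule X)
    have m: "real m \<le> d / X n" "d / X n < real m + 1"
      using d X0 by (auto simp: m_def)
    have sub: "{k. X n * (real k - real (N n)) \<in> {- d..0}} \<subseteq> {N n - m..N n}"
    proof
      fix k assume "k \<in> {k. X n * (real k - real (N n)) \<in> {- d..0}}"
      then have k: "- d \<le> X n * (real k - real (N n))" "X n * (real k - real (N n)) \<le> 0"
        by auto
      have "k \<le> N n"
        using k(2) X0 by (simp add: mult_le_0_iff)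
      have "real (N n) - real k \<le> d / X n"
        using k(1) X0 by (simp add: field_simps)
      then have "real (N n) < real (k + m + 1)"
        using m(2) by simp
      then show "k \<in> {N n - m..N n}"
        using \<open>k \<le> N n\<close> unfolding of_nat_less_iff by auto
    qed
    have "T n * W (- d) 0 n = (\<Sum>k | X n * (real k - real (N n)) \<in> {- d..0}. b k * exp (- (X n * real k)))"
      using T[of n] by (simp add: W_def)
    also have "\<dots> \<le> (\<Sum>k | X n * (real k - real (N n)) \<in> {- d..0}. b (N n) * exp (- (X n * real (N n)) + d))"
    proof (rule sum_mono)
      fix k assume k: "k \<in> {k. X n * (real k - real (N n)) \<in> {- d..0}}"
      then have "- (X n * real k) \<le> - (X n * real (N n)) + d"
        by (simp add: right_diff_distrib)
      then show "b k * exp (- (X n * real k)) \<le> b (N n) * exp (- (X n * real (N n)) + d)"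
        using k sub monoD[OF mono, of k "N n"] b_nonneg by (intro mult_mono) auto
    qed
    also have "\<dots> \<le> (\<Sum>k\<in>{N n - m..N n}. b (N n) * exp (- (X n * real (N n)) + d))"
      using b_nonneg by (intro sum_mono2 sub) auto
    also have "\<dots> = real (card {N n - m..N n}) * (b (N n) * exp (- (X n * real (N n)) + d))"
      by simp
    also have "\<dots> \<le> (d / X n + 1) * (b (N n) * exp (- (X n * real (N n)) + d))"
    proof (rule mult_right_mono)
      have "card {N n - m..N n} \<le> m + 1"
        by simp
      then have "real (card {N n - m..N n}) \<le> real m + 1"
        by linarith
      then show "real (card {N n - m..N n}) \<le> d / X n + 1"
        using m(1) by linarith
    qed (use b_nonneg in auto)
    also have "\<dots> = T n * (U n * ((d + X n) * exp d))"
      using T[of n] X0 unfolding U_def exp_add by (simp add: field_simps)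
    finally have "W (- d) 0 n \<le> U n * ((d + X n) * exp d)"
      using mult_le_cancel_left_pos[OF T[of n]] by blast
    moreover have "(d + X n) * exp d > 0"
      using d X0 by simp
    ultimately have "W (- d) 0 n / ((d + X n) * exp d) \<le> U n"
      by (simp only: pos_divide_le_eq)
    then show ?thesis
      by (simp add: exp_minus inverse_eq_divide mult.commute)
  qed
  have "U \<longlonglongrightarrow> \<kappa>"
  proof (rule order_tendstoI)
    fix y assume y: "y < \<kappa>"
    have "((\<lambda>d. exp (- d) * \<kappa>) \<longlongrightarrow> exp (- 0) * \<kappa>) (at_right 0)"
      by (intro tendsto_intros)
    then have "\<forall>\<^sub>F d in at_right 0. y < exp (- d) * \<kappa>"
      using y by (intro order_tendstoD) auto
    then have "\<forall>\<^sub>F d in at_right 0. 0 < d \<and> y < exp (- d) * \<kappa>"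
      using eventually_at_right_less[of 0] by eventually_elim auto
    then obtain d where d: "0 < d" "y < exp (- d) * \<kappa>"
      using eventually_happens[of _ "at_right (0::real)"] by auto
    have "(\<lambda>n. exp (- d) / (d + X n) * W (- d) 0 n) \<longlonglongrightarrow> exp (- d) / (d + 0) * ((0 - - d) * \<kappa>)"
      using d by (intro tendsto_intros X(2) W) auto
    then have "\<forall>\<^sub>F n in sequentially. y < exp (- d) / (d + X n) * W (- d) 0 n"
      using d by (intro order_tendstoD) auto
    then show "\<forall>\<^sub>F n in sequentially. y < U n"
      by eventually_elim (use lower[OF d(1)] less_le_trans in blast)
  next
    fix y assume y: "\<kappa> < y"
    have "((\<lambda>d. exp d * \<kappa>) \<longlongrightarrow> exp 0 * \<kappa>) (at_right 0)"
      by (intro tendsto_intros)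
    then have "\<forall>\<^sub>F d in at_right 0. exp d * \<kappa> < y"
      using y by (intro order_tendstoD) auto
    then have "\<forall>\<^sub>F d in at_right 0. 0 < d \<and> exp d * \<kappa> < y"
      using eventually_at_right_less[of 0] by eventually_elim auto
    then obtain d where d: "0 < d" "exp d * \<kappa> < y"
      using eventually_happens[of _ "at_right (0::real)"] by auto
    have "(\<lambda>n. exp d / d * W 0 d n) \<longlonglongrightarrow> exp d / d * ((d - 0) * \<kappa>)"
      using d by (intro tendsto_intros W) auto
    then have "\<forall>\<^sub>F n in sequentially. exp d / d * W 0 d n < y"
      using d by (intro order_tendstoD) auto
    then show "\<forall>\<^sub>F n in sequentially. U n < y"
      by eventually_elim (use upper[OF d(1)] le_less_trans in blast)
  qed
  then show ?thesis
    by (simp add: U_def[abs_def] T_def \<kappa>_def)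
qed

end

section \<open>Evaluation at the saddle point\<close>

text \<open>
The claimed asymptotics of the partial sums. Those of the coefficients are its product with the saddle point
sqrt (\<gamma> / N).
\<close>

definition cumulative_asymptotic :: "real \<Rightarrow> real \<Rightarrow> real \<Rightarrow> real \<Rightarrow> real \<Rightarrow> real" where
  "cumulative_asymptotic lam \<alpha> \<beta> \<gamma> N = lam * \<gamma> powr (\<beta> / 2 - 1 / 4) * ln N powr \<alpha>
      / (2 powr (\<alpha> + 1) * sqrt pi * N powr (\<beta> / 2 + 1 / 4)) * exp (2 * sqrt (\<gamma> * N))"

lemma powr_sqrt_quotient:
  fixes \<gamma> N s :: real
  assumes "\<gamma> > 0" "N > 0"
  shows "sqrt (\<gamma> / N) powr s = \<gamma> powr (s / 2) / N powr (s / 2)"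
proof -
  have "sqrt (\<gamma> / N) = (\<gamma> / N) powr (1 / 2)"
    using assms by (simp add: powr_half_sqrt)
  then have "sqrt (\<gamma> / N) powr s = (\<gamma> / N) powr (s / 2)"
    by (simp add: powr_powr)
  also have "\<dots> = \<gamma> powr (s / 2) / N powr (s / 2)"
    using assms by (simp add: powr_divide)
  finally show ?thesis .
qed

text \<open>
At the saddle point x = sqrt (\<gamma> / N) both \<gamma> / x and x N are equal to sqrt (\<gamma> N), and ln (1 / x) is ln N / 2 up
to a bounded term; everything except the logarithm can be evaluated exactly.
\<close>

lemma saddle_value:
  fixes \<gamma> N :: real
  assumes \<gamma>: "\<gamma> > 0" and N: "N > 1" and x: "x = sqrt (\<gamma> / N)" "x < 1"
  shows "lam * growth \<alpha> \<beta> \<gamma> x * sqrt x * exp (x * N) / (2 * sqrt (pi * \<gamma>))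
      = cumulative_asymptotic lam \<alpha> \<beta> \<gamma> N * (ln (1 / x) / (ln N / 2)) powr \<alpha>"
proof -
  have x0: "x > 0" using \<gamma> N x by simp
  have lnx: "ln (1 / x) > 0" using x0 x(2) by (intro ln_gt_zero) auto
  have lnN: "ln N > 0" using N by simp
  have "ln (1 / x) powr \<alpha> = ((ln N / 2) * (ln (1 / x) / (ln N / 2))) powr \<alpha>"
    using lnN by simp
  also have "\<dots> = (ln N / 2) powr \<alpha> * (ln (1 / x) / (ln N / 2)) powr \<alpha>"
    by (rule powr_mult)
  also have "(ln N / 2) powr \<alpha> = ln N powr \<alpha> / 2 powr \<alpha>"
    using lnN by (simp add: powr_divide)
  finally have 1: "ln (1 / x) powr \<alpha> = ln N powr \<alpha> / 2 powr \<alpha> * (ln (1 / x) / (ln N / 2)) powr \<alpha>" .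
  have "x powr \<beta> * sqrt x = x powr (\<beta> + 1 / 2)"
    using x0 by (simp add: powr_add powr_half_sqrt)
  also have "\<dots> = \<gamma> powr ((\<beta> + 1 / 2) / 2) / N powr ((\<beta> + 1 / 2) / 2)"
    unfolding x(1) using \<gamma> N by (intro powr_sqrt_quotient) auto
  also have "(\<beta> + 1 / 2) / 2 = (\<beta> / 2 - 1 / 4) + 1 / 2"
    by (simp add: field_simps)
  also have "\<gamma> powr ((\<beta> / 2 - 1 / 4) + 1 / 2) = \<gamma> powr (\<beta> / 2 - 1 / 4) * sqrt \<gamma>"
    using \<gamma> by (simp only: powr_add powr_half_sqrt less_imp_le)
  also have "(\<beta> / 2 - 1 / 4) + 1 / 2 = \<beta> / 2 + 1 / 4"
    by simp
  finally have 2: "x powr \<beta> * sqrt x = \<gamma> powr (\<beta> / 2 - 1 / 4) * sqrt \<gamma> / N powr (\<beta> / 2 + 1 / 4)" .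
  have "N = sqrt N * sqrt N" "\<gamma> = sqrt \<gamma> * sqrt \<gamma>"
    using \<gamma> N by auto
  then have "\<gamma> / x = sqrt (\<gamma> * N)" "x * N = sqrt (\<gamma> * N)"
    using \<gamma> N unfolding x(1) real_sqrt_divide real_sqrt_mult by (auto simp: field_simps)
  then have 3: "exp (\<gamma> / x) * exp (x * N) = exp (2 * sqrt (\<gamma> * N))"
    by (simp flip: exp_add)
  have 4: "2 powr (\<alpha> + 1) = 2 powr \<alpha> * (2 :: real)"
    by (simp add: powr_add)
  have "lam * growth \<alpha> \<beta> \<gamma> x * sqrt x * exp (x * N) / (2 * sqrt (pi * \<gamma>))
      = lam * ln (1 / x) powr \<alpha> * (x powr \<beta> * sqrt x) * (exp (\<gamma> / x) * exp (x * N)) / (2 * (sqrt pi * sqrt \<gamma>))"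
    unfolding growth_def real_sqrt_mult by (simp only: ac_simps)
  also have "\<dots> = cumulative_asymptotic lam \<alpha> \<beta> \<gamma> N * (ln (1 / x) / (ln N / 2)) powr \<alpha>"
    unfolding 1 2 3 cumulative_asymptotic_def 4 using \<gamma> by (simp add: mult_ac)
  finally show ?thesis .
qed

context ingham
begin

lemma saddle_sequence:
  defines "X \<equiv> \<lambda>n. sqrt (\<gamma> / real (Suc n))"
  shows "X n > 0" "X \<longlonglongrightarrow> 0" "\<gamma> / (X n)\<^sup>2 = real (Suc n)"
proof -
  show "X n > 0" "\<gamma> / (X n)\<^sup>2 = real (Suc n)"
    using gamma_pos by (simp_all add: X_def)
  have "(\<lambda>n. \<gamma> / real (Suc n)) \<longlonglongrightarrow> 0"
    using LIMSEQ_Suc[OF lim_const_over_n[of \<gamma>]] by simp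
  then show "X \<longlonglongrightarrow> 0"
    unfolding X_def using tendsto_real_sqrt by fastforce
qed

text \<open>
Here the radial asymptotics of f enter, together with ln (1 / x) / (ln N / 2) = 1 - ln \<gamma> / ln N.
\<close>

lemma saddle_limit:
  defines "X \<equiv> \<lambda>n. sqrt (\<gamma> / real (Suc n))"
  shows "(\<lambda>n. f (X n) * sqrt (X n) * exp (X n * real (Suc n)) / (2 * sqrt (pi * \<gamma>))
      / cumulative_asymptotic lam \<alpha> \<beta> \<gamma> (real (Suc n))) \<longlonglongrightarrow> 1"
proof -
  have X0: "X n > 0" for n
    unfolding X_def by (rule saddle_sequence)
  have X_lim: "X \<longlonglongrightarrow> 0"
    unfolding X_def by (rule saddle_sequence)
  have "filterlim X (at_right 0) sequentially"
    using X_lim X0 less_imp_neq[OF X0] by (auto simp: filterlim_at intro!: always_eventually)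
  from filterlim_compose[OF radial this] have 1: "(\<lambda>n. f (X n) / L (X n)) \<longlonglongrightarrow> lam" .
  have "(\<lambda>N. 1 - ln \<gamma> / ln (real N)) \<longlonglongrightarrow> 1"
    by real_asymp
  then have "(\<lambda>n. 1 - ln \<gamma> / ln (real (Suc n))) \<longlonglongrightarrow> 1"
    by (rule LIMSEQ_Suc)
  then have "(\<lambda>n. (1 - ln \<gamma> / ln (real (Suc n))) powr \<alpha>) \<longlonglongrightarrow> 1 powr \<alpha>"
    by (intro tendsto_powr tendsto_const) auto
  then have "(\<lambda>n. f (X n) / L (X n) / lam * (1 - ln \<gamma> / ln (real (Suc n))) powr \<alpha>) \<longlonglongrightarrow> lam / lam * 1 powr \<alpha>"
    using lam_pos by (intro tendsto_mult tendsto_divide 1 tendsto_const) auto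
  then have "(\<lambda>n. f (X n) / L (X n) / lam * (1 - ln \<gamma> / ln (real (Suc n))) powr \<alpha>) \<longlonglongrightarrow> 1"
    using lam_pos by simp
  then show ?thesis
  proof (rule Lim_transform_eventually)
    show "\<forall>\<^sub>F n in sequentially. f (X n) / L (X n) / lam * (1 - ln \<gamma> / ln (real (Suc n))) powr \<alpha>
        = f (X n) * sqrt (X n) * exp (X n * real (Suc n)) / (2 * sqrt (pi * \<gamma>))
      / cumulative_asymptotic lam \<alpha> \<beta> \<gamma> (real (Suc n))"
      using order_tendstoD(2)[OF X_lim zero_less_one] eventually_gt_at_top[of 0]
    proof eventually_elim
      case (elim n)
      define N where "N = real (Suc n)"
      define P where "P = cumulative_asymptotic lam \<alpha> \<beta> \<gamma> N"
      define E where "E = sqrt (X n) * exp (X n * N) / (2 * sqrt (pi * \<gamma>))"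
      have N: "N > 1" using elim by (simp add: N_def)
      have XN: "X n = sqrt (\<gamma> / N)" by (simp add: X_def N_def)
      have P: "P > 0"
        unfolding P_def cumulative_asymptotic_def using lam_pos gamma_pos N
        by (intro mult_pos_pos divide_pos_pos) auto
      have Lpos: "L (X n) > 0"
        using growth_pos[OF X0] elim by simp
      have "ln (1 / X n) = (ln N - ln \<gamma>) / 2"
        unfolding XN using gamma_pos N by (simp add: ln_div ln_sqrt field_simps)
      then have ratio: "ln (1 / X n) / (ln N / 2) = 1 - ln \<gamma> / ln N"
        using N by (simp add: field_simps)
      have "lam * L (X n) * E = P * (1 - ln \<gamma> / ln N) powr \<alpha>"
        using saddle_value[OF gamma_pos N XN, of lam \<alpha> \<beta>, unfolded ratio] elim
        by (simp add: E_def P_def mult.assoc)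
      then have "(1 - ln \<gamma> / ln N) powr \<alpha> = lam * L (X n) * E / P"
        using P by simp
      then have "f (X n) / L (X n) / lam * (1 - ln \<gamma> / ln N) powr \<alpha> = f (X n) * E / P"
        using Lpos lam_pos by simp
      then show ?case
        by (simp add: E_def P_def N_def)
    qed
  qed
qed

text \<open>
Both limits of the previous section have this form, with h constant for the partial sums and h n equal to the saddle
point for the coefficients.
\<close>

lemma asymp_equiv_of_saddle_limit:
  fixes g h :: "nat \<Rightarrow> real"
  assumes g: "(\<lambda>n. g (Suc n) * exp (- (sqrt (\<gamma> / real (Suc n)) * real (Suc n))) / (h (Suc n) *
      (f (sqrt (\<gamma> / real (Suc n))) * sqrt (sqrt (\<gamma> / real (Suc n))))))
     \<longlonglongrightarrow> 1 / (2 * sqrt (pi * \<gamma>))"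
    and h: "\<And>n. h (Suc n) > 0"
  shows "g \<sim>[at_top] (\<lambda>n. h n * cumulative_asymptotic lam \<alpha> \<beta> \<gamma> (real n))"
proof (rule asymp_equivI')
  let ?P = "\<lambda>n. cumulative_asymptotic lam \<alpha> \<beta> \<gamma> (real (Suc n))"
  let ?X = "\<lambda>n. sqrt (\<gamma> / real (Suc n))"
  define \<kappa> where "\<kappa> = 2 * sqrt (pi * \<gamma>)"
  have \<kappa>: "\<kappa> > 0" using gamma_pos by (simp add: \<kappa>_def)
  define A where "A n = f (?X n) * sqrt (?X n)" for n
  define D where "D n = exp (?X n * real (Suc n))" for n
  have A: "A n > 0" for n
    using gamma_pos f_pos by (simp add: A_def)
  have D: "D n > 0" for n
    by (simp add: D_def)
  have "(\<lambda>n. g (Suc n) / D n / (h (Suc n) * A n)) \<longlonglongrightarrow> 1 / \<kappa>"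
    using g unfolding A_def D_def \<kappa>_def exp_minus by (simp only: divide_inverse mult_1)
  moreover have "(\<lambda>n. A n * D n / \<kappa> / ?P n) \<longlonglongrightarrow> 1"
    unfolding A_def D_def \<kappa>_def by (rule saddle_limit)
  ultimately have "(\<lambda>n. g (Suc n) / D n / (h (Suc n) * A n) * \<kappa> * (A n * D n / \<kappa> / ?P n))
      \<longlonglongrightarrow> 1 / \<kappa> * \<kappa> * 1"
    by (intro tendsto_mult tendsto_const)
  moreover have eq: "1 / \<kappa> * \<kappa> * 1 = 1"
    using \<kappa> by simp
  ultimately have "(\<lambda>n. g (Suc n) / D n / (h (Suc n) * A n) * \<kappa> * (A n * D n / \<kappa> / ?P n)) \<longlonglongrightarrow> 1"
    using eq by (simp only:)
  moreover have "g (Suc n) / D n / (h (Suc n) * A n) * \<kappa> * (A n * D n / \<kappa> / ?P n) = g (Suc n) / (h (Suc n) * ?P n)" for n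
    using \<kappa> A[of n] D[of n] h[of n] by simp
  ultimately have "(\<lambda>n. g (Suc n) / (h (Suc n) * ?P n)) \<longlonglongrightarrow> 1"
    by (simp only:)
  then show "(\<lambda>n. g n / (h n * cumulative_asymptotic lam \<alpha> \<beta> \<gamma> (real n))) \<longlonglongrightarrow> 1"
    by (rule LIMSEQ_imp_Suc)
qed

theorem ingham_partial_sums:
  "(\<lambda>N. \<Sum>n=0..N. b n) \<sim>[at_top] (\<lambda>N. cumulative_asymptotic lam \<alpha> \<beta> \<gamma> (real N))"
proof -
  have "(\<lambda>N. \<Sum>n\<le>N. b n) \<sim>[at_top] (\<lambda>N. 1 * cumulative_asymptotic lam \<alpha> \<beta> \<gamma> (real N))"
    using partial_sum_limit[OF saddle_sequence]
    by (intro asymp_equiv_of_saddle_limit[where h = "\<lambda>_. 1"]) simp_all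
  then show ?thesis
    by (simp add: atMost_atLeast0)
qed

theorem ingham_coefficients:
  assumes "mono b"
  shows "b \<sim>[at_top] (\<lambda>n. sqrt (\<gamma> / real n) * cumulative_asymptotic lam \<alpha> \<beta> \<gamma> (real n))"
  using coefficient_limit[OF saddle_sequence assms] gamma_pos
  by (intro asymp_equiv_of_saddle_limit[where h = "\<lambda>n. sqrt (\<gamma> / real n)"]) simp_all

end

lemma cumulative_asymptotic_times_saddle:
  fixes \<gamma> N :: real
  assumes \<gamma>: "\<gamma> > 0" and N: "N > 0"
  shows "sqrt (\<gamma> / N) * cumulative_asymptotic lam \<alpha> \<beta> \<gamma> N
    = lam * \<gamma> powr (\<beta> / 2 + 1 / 4) * ln N powr \<alpha>
                / (2 powr (\<alpha> + 1) * sqrt pi * N powr (\<beta> / 2 + 3 / 4))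
                * exp (2 * sqrt (\<gamma> * N))"
proof -
  have "\<gamma> powr (\<beta> / 2 + 1 / 4) = \<gamma> powr ((\<beta> / 2 - 1 / 4) + 1 / 2)"
    by (rule arg_cong[where f = "\<lambda>s. \<gamma> powr s"]) simp
  also have "\<dots> = \<gamma> powr (\<beta> / 2 - 1 / 4) * sqrt \<gamma>"
    using \<gamma> by (simp only: powr_add powr_half_sqrt less_imp_le)
  finally have 1: "\<gamma> powr (\<beta> / 2 + 1 / 4) = \<gamma> powr (\<beta> / 2 - 1 / 4) * sqrt \<gamma>" .
  have "N powr (\<beta> / 2 + 3 / 4) = N powr ((\<beta> / 2 + 1 / 4) + 1 / 2)"
    by (rule arg_cong[where f = "\<lambda>s. N powr s"]) simp
  also have "\<dots> = N powr (\<beta> / 2 + 1 / 4) * sqrt N"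
    using N by (simp only: powr_add powr_half_sqrt less_imp_le)
  finally have 2: "N powr (\<beta> / 2 + 3 / 4) = N powr (\<beta> / 2 + 1 / 4) * sqrt N" .
  show ?thesis
    unfolding cumulative_asymptotic_def 1 2 real_sqrt_divide by (simp add: mult_ac)
qed

lemma summable_power_series_exp:
  fixes b :: "nat \<Rightarrow> real"
  assumes "conv_radius b \<ge> 1" "x > 0"
  shows "summable (\<lambda>n. b n * exp (- (x * real n)))"
proof -
  have "ereal (norm (exp (- x))) < 1"
    using assms(2) by simp
  also note assms(1)
  finally have "summable (\<lambda>n. b n * exp (- x) ^ n)"
    by (rule summable_in_conv_radius)
  then show ?thesis
    by (simp add: exp_of_nat_mult[symmetric] mult.commute)
qed

text \<open>
A negative lam is impossible because f is nonnegative while its asymptotics would be negative. If lam = 0, asymptotic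
equivalence to the zero function means that f vanishes near 0, so all coefficients are zero and both claims are
equivalences of zero functions. The remaining case is the situation of the locale.
\<close>

theorem theorem1p1:
  fixes b :: "nat \<Rightarrow> real" and B :: "complex \<Rightarrow> complex"
    and lam \<alpha> \<beta> \<gamma> :: real
  assumes B_series: "B = (\<lambda>q. \<Sum>n. complex_of_real (b n) * q ^ n)"
    and b_nonneg: "\<And>n. b n \<ge> 0"
    and radius: "conv_radius b \<ge> 1"
    and \<gamma>_pos: "\<gamma> > 0"
    and radial:
      "(\<lambda>t::real. B (exp (- complex_of_real t))) \<sim>[at_right 0]
       (\<lambda>t. complex_of_real (lam * ln (1 / t) powr \<alpha> * t powr \<beta> * exp (\<gamma> / t)))"
    and angular: "\<And>\<Delta>::real. \<Delta> > 0 \<Longrightarrow>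
      (\<lambda>z. cmod (B (exp (- z))))
        \<in> O[at 0 within {z. Re z > 0 \<and> \<bar>Im z\<bar> \<le> \<Delta> * Re z}](
            \<lambda>z. ln (1 / cmod z) powr \<alpha> * cmod z powr \<beta> * exp (\<gamma> / cmod z))"
  shows "((\<lambda>N::nat. \<Sum>n=0..N. b n) \<sim>[at_top]
           (\<lambda>N. lam * \<gamma> powr (\<beta> / 2 - 1 / 4) * ln (real N) powr \<alpha>
                / (2 powr (\<alpha> + 1) * sqrt pi * real N powr (\<beta> / 2 + 1 / 4))
                * exp (2 * sqrt (\<gamma> * real N))))
         \<and> (mono b \<longrightarrow>
         (b \<sim>[at_top]
           (\<lambda>n. lam * \<gamma> powr (\<beta> / 2 + 1 / 4) * ln (real n) powr \<alpha>
                / (2 powr (\<alpha> + 1) * sqrt pi * real n powr (\<beta> / 2 + 3 / 4))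
                * exp (2 * sqrt (\<gamma> * real n)))))"
proof -
  define f where "f = (\<lambda>x. \<Sum>n. b n * exp (- (x * real n)))"
  define F where "F = (\<lambda>z. \<Sum>n. complex_of_real (b n) * exp (- (z * of_nat n)))"
  have summable: "summable (\<lambda>n. b n * exp (- (x * real n)))" if "x > 0" for x
    using radius that by (rule summable_power_series_exp)
  have BF: "B (exp (- z)) = F z" for z
    by (simp add: B_series F_def exp_of_nat2_mult[symmetric])
  have Ff: "F (of_real x) = of_real (f x)" if "x > 0" for x
    unfolding F_def f_def by (rule suminf_exp_of_real[OF summable[OF that]])
  have f_nonneg: "f x \<ge> 0" if "x > 0" for x
    unfolding f_def using summable[OF that] b_nonneg by (intro suminf_nonneg) auto
  have pos: "\<forall>\<^sub>F t::real in at_right 0. t > 0"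
    by (simp add: eventually_at_right_less)
  have small: "\<forall>\<^sub>F t::real in at_right 0. t < 1"
    by (auto simp: eventually_at_right_field intro: exI[of _ 1])
  have ratio: "((\<lambda>t. if f t = 0 \<and> lam * growth \<alpha> \<beta> \<gamma> t = 0 then 1 else f t / (lam * growth \<alpha> \<beta> \<gamma> t)) \<longlongrightarrow> 1) (at_right 0)"
  proof -
    have "((\<lambda>t. complex_of_real (if f t = 0 \<and> lam * growth \<alpha> \<beta> \<gamma> t = 0 then 1 else f t / (lam * growth \<alpha> \<beta> \<gamma> t))) \<longlongrightarrow> of_real 1) (at_right 0)"
    proof (rule Lim_transform_eventually)
      show "((\<lambda>t. if B (exp (- complex_of_real t)) = 0 \<and> complex_of_real (lam * ln (1 / t) powr \<alpha> * t powr \<beta> * exp (\<gamma> / t)) = 0 then 1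
         else B (exp (- complex_of_real t)) / complex_of_real (lam * ln (1 / t) powr \<alpha> * t powr \<beta> * exp (\<gamma> / t))) \<longlongrightarrow> of_real 1) (at_right 0)"
        using radial unfolding asymp_equiv_def of_real_1 .
      show "\<forall>\<^sub>F t in at_right 0. (if B (exp (- complex_of_real t)) = 0 \<and> complex_of_real (lam * ln (1 / t) powr \<alpha> * t powr \<beta> * exp (\<gamma> / t)) = 0 then 1
         else B (exp (- complex_of_real t)) / complex_of_real (lam * ln (1 / t) powr \<alpha> * t powr \<beta> * exp (\<gamma> / t)))
         = complex_of_real (if f t = 0 \<and> lam * growth \<alpha> \<beta> \<gamma> t = 0 then 1 else f t / (lam * growth \<alpha> \<beta> \<gamma> t))"
        using pos
      proof eventually_elim
        case (elim t)
        have g: "lam * ln (1 / t) powr \<alpha> * t powr \<beta> * exp (\<gamma> / t) = lam * growth \<alpha> \<beta> \<gamma> t"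
          by (simp add: growth_def)
        show ?case
          unfolding g BF Ff[OF elim] by (auto simp del: of_real_mult)
      qed
    qed
    then show ?thesis
      by (simp only: tendsto_of_real_iff)
  qed
  consider "lam = 0" | "lam < 0" | "lam > 0" by linarith
  then show ?thesis
  proof cases
    case 1
    have "\<forall>\<^sub>F t in at_right 0. (if f t = 0 \<and> lam * growth \<alpha> \<beta> \<gamma> t = 0 then 1 else f t / (lam * growth \<alpha> \<beta> \<gamma> t)) > 0"
      using ratio by (rule order_tendstoD) simp
    with pos have "\<forall>\<^sub>F t in at_right 0. t > 0 \<and> f t = 0"
      by eventually_elim (use 1 in \<open>auto split: if_splits\<close>)
    then obtain t where t: "t > 0" "f t = 0"
      using eventually_happens[of _ "at_right (0::real)"] by auto
    have "b n = 0" for n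
    proof -
      have "b n * exp (- (t * real n)) = 0"
        using suminf_eq_zero_iff[OF summable[OF t(1)]] b_nonneg t(2) by (simp add: f_def)
      then show ?thesis by simp
    qed
    then have "b = (\<lambda>_. 0)" by auto
    with 1 show ?thesis by simp
  next
    case 2
    have "\<forall>\<^sub>F t in at_right 0. (if f t = 0 \<and> lam * growth \<alpha> \<beta> \<gamma> t = 0 then 1 else f t / (lam * growth \<alpha> \<beta> \<gamma> t)) > 0"
      using ratio by (rule order_tendstoD) simp
    with pos small have "\<forall>\<^sub>F t::real in at_right 0. False"
    proof eventually_elim
      case (elim t)
      have "lam * growth \<alpha> \<beta> \<gamma> t < 0"
        using 2 growth_pos[of t] elim by (simp add: mult_neg_pos)
      then show False
        using elim f_nonneg[of t] by (auto simp: zero_less_divide_iff split: if_splits)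
    qed
    then show ?thesis
      by (simp add: trivial_limit_at_right_real)
  next
    case 3
    interpret ingham b lam \<alpha> \<beta> \<gamma> f F
    proof
      show "((\<lambda>t. f t / growth \<alpha> \<beta> \<gamma> t) \<longlongrightarrow> lam) (at_right 0)"
      proof (rule Lim_transform_eventually)
        show "((\<lambda>t. lam * (if f t = 0 \<and> lam * growth \<alpha> \<beta> \<gamma> t = 0 then 1 else f t / (lam * growth \<alpha> \<beta> \<gamma> t))) \<longlongrightarrow> lam) (at_right 0)"
          using tendsto_mult_left[OF ratio, of lam] by simp
        show "\<forall>\<^sub>F t in at_right 0. lam * (if f t = 0 \<and> lam * growth \<alpha> \<beta> \<gamma> t = 0 then 1 else f t / (lam * growth \<alpha> \<beta> \<gamma> t))
            = f t / growth \<alpha> \<beta> \<gamma> t"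
          using pos small
        proof eventually_elim
          case (elim t)
          then show ?case
            using 3 growth_pos[of t \<alpha> \<beta> \<gamma>] by simp
        qed
      qed
      show "\<exists>C d. d > 0 \<and> (\<forall>z. Re z > 0 \<longrightarrow> \<bar>Im z\<bar> \<le> \<Delta> * Re z \<longrightarrow> cmod z < d \<longrightarrow>
          cmod (F z) \<le> C * growth \<alpha> \<beta> \<gamma> (cmod z))" if \<Delta>: "\<Delta> > 0" for \<Delta>
      proof -
        obtain C where "\<forall>\<^sub>F z in at 0 within {z. Re z > 0 \<and> \<bar>Im z\<bar> \<le> \<Delta> * Re z}.
            norm (cmod (B (exp (- z)))) \<le> C * norm (ln (1 / cmod z) powr \<alpha> * cmod z powr \<beta> * exp (\<gamma> / cmod z))"
          using angular[OF \<Delta>] by (elim landau_o.bigE)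
        then obtain d where d: "d > 0" "\<And>z. Re z > 0 \<Longrightarrow> \<bar>Im z\<bar> \<le> \<Delta> * Re z \<Longrightarrow> z \<noteq> 0 \<Longrightarrow> dist z 0 < d \<Longrightarrow>
            norm (cmod (B (exp (- z)))) \<le> C * norm (ln (1 / cmod z) powr \<alpha> * cmod z powr \<beta> * exp (\<gamma> / cmod z))"
          unfolding eventually_at by blast
        have "cmod (F z) \<le> C * growth \<alpha> \<beta> \<gamma> (cmod z)" if "Re z > 0" "\<bar>Im z\<bar> \<le> \<Delta> * Re z" "cmod z < d" for z
        proof -
          have "z \<noteq> 0" using that(1) by auto
          with d(2)[of z] that show ?thesis
            by (simp add: BF growth_def abs_mult)
        qed
        with d(1) show ?thesis by blast
      qed
    qed (use b_nonneg summable \<gamma>_pos 3 in \<open>auto simp: f_def F_def\<close>)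
    have 1: "(\<lambda>N. \<Sum>n=0..N. b n) \<sim>[at_top]
           (\<lambda>N. lam * \<gamma> powr (\<beta> / 2 - 1 / 4) * ln (real N) powr \<alpha>
                / (2 powr (\<alpha> + 1) * sqrt pi * real N powr (\<beta> / 2 + 1 / 4))
                * exp (2 * sqrt (\<gamma> * real N)))"
      using ingham_partial_sums by (simp only: cumulative_asymptotic_def)
    have 2: "b \<sim>[at_top]
           (\<lambda>n. lam * \<gamma> powr (\<beta> / 2 + 1 / 4) * ln (real n) powr \<alpha>
                / (2 powr (\<alpha> + 1) * sqrt pi * real n powr (\<beta> / 2 + 3 / 4))
                * exp (2 * sqrt (\<gamma> * real n)))" if "mono b"
    proof -
      have "\<forall>\<^sub>F n in at_top. sqrt (\<gamma> / real n) * cumulative_asymptotic lam \<alpha> \<beta> \<gamma> (real n)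
          = lam * \<gamma> powr (\<beta> / 2 + 1 / 4) * ln (real n) powr \<alpha>
                / (2 powr (\<alpha> + 1) * sqrt pi * real n powr (\<beta> / 2 + 3 / 4))
                * exp (2 * sqrt (\<gamma> * real n))"
        using eventually_gt_at_top[of 0]
        by eventually_elim (intro cumulative_asymptotic_times_saddle \<gamma>_pos, simp)
      from asymp_equiv_transfer[OF ingham_coefficients[OF that] _ this] show ?thesis
        by simp
    qed
    from 1 2 show ?thesis by blast
  qed
qed

end
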